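(* Let $K$ be a field, $R=K[x_1,\ldots,x_r]$, let $1\leq d\leq n$, and let $L=(\ell_1,\ldots,\ell_n)$ be linear polynomials in $R$ (not necessarily homogeneous or distinct) such that the ideal $$I_{L,d}=\langle\ell_{i_1}\cdots\ell_{i_d}:1\leq i_1<\cdots<i_d\leq n\rangle\subset R$$ is nonzero. Then $I_{L,d}$ has the primary decomposition $$I_{L,d}=\bigcap_{S}(I_S)^{d-n+|S|},$$ where the intersection is over all subsets $S\subset[n]$ such that: (1) $S$ is a flat of the hyperplane arrangement associated with the homogenizations $\ell_1',\ldots,\ell_n'$ of $\ell_1,\ldots,\ell_n$; (2) the hyperplane at infinity is not in the span of this flat, i.e. $x_{r+1}\notin J_S$; and (3) $|S|\geq n-d+1$.
   Context: Notation: $[n]=\{1,\ldots,n\}$. Each $\ell_i$ is either of degree 1 or zero (some $\ell_i$ may be zero and repetitions are allowed). The homogenization $\ell_i'\in R'=K[x_1,\ldots,x_{r+1}]$ of $\ell_i=c_{i0}+\sum_{j=1}^r c_{ij}x_j$ is the linear form $\ell_i'=c_{i0}x_{r+1}+\sum_{j=1}^r c_{ij}x_j$. For $S\subset[n]$ set $I_S=\langle\ell_i:i\in S\rangle\subset R$ and $J_S=\langle\ell_i':i\in S\rangle\subset R'$. Flats: for $S\subset[n]$ let $\mathrm{rk}(S)$ be the dimension of the $K$-span of $\{\ell_i':i\in S\}$. A flat of the arrangement of the $\ell_i'$ is a subset $S\subset[n]$ such that $\mathrm{rk}(S\cup\{i\})>\mathrm{rk}(S)$ for all $i\in[n]\setminus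 S$. An intersection over an empty family of ideals is $R$. "Primary decomposition" means that each ideal $(I_S)^{d-n+|S|}$ in the intersection is primary and the stated equality holds; the decomposition is not claimed to be minimal. *)

theory Defs
  imports Complex_Main "HOL-Library.Poly_Mapping"
begin

text \<open>
  The polynomial ring over the field \<open>'k\<close> in the variables indexed by the finite type \<open>'v\<close>:
  finitely supported maps from exponent vectors to coefficients, with the convolution product of
  \<^theory>\<open>HOL-Library.Poly_Mapping\<close>. Adjoining the homogenizing variable \<open>x\<^sub>r\<^sub>+\<^sub>1\<close> means passing from
  \<open>'v\<close> to \<open>'v option\<close>, with \<open>None\<close> as the index of the new variable.
\<close>

type_synonym ('v, 'k) mpoly = "('v \<Rightarrow>\<^sub>0 nat) \<Rightarrow>\<^sub>0 'k"

definition Var :: "'v \<Rightarrow> ('v, 'k::field) mpoly" where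
  "Var v = Poly_Mapping.single (Poly_Mapping.single v 1) 1"

definition Const :: "'k \<Rightarrow> ('v, 'k::field) mpoly" where
  "Const c = Poly_Mapping.single 0 c"

definition total_degree :: "('v::finite, 'k::field) mpoly \<Rightarrow> nat" where
  "total_degree p =
     Max (insert 0 ((\<lambda>m. \<Sum>v\<in>UNIV. Poly_Mapping.lookup m v) ` Poly_Mapping.keys p))"

text \<open>With this convention nonzero constants are not linear polynomials.\<close>

definition linear_poly :: "('v::finite, 'k::field) mpoly \<Rightarrow> bool" where
  "linear_poly p \<longleftrightarrow> p = 0 \<or> total_degree p = 1"

definition homogenization :: "('v::finite, 'k::field) mpoly \<Rightarrow> ('v option, 'k) mpoly" where
  "homogenization p =
     Const (Poly_Mapping.lookup p 0) * Var None +
     (\<Sum>v\<in>UNIV. Const (Poly_Mapping.lookup p (Poly_Mapping.single v 1)) * Var (Some v))"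

definition mscale :: "'k \<Rightarrow> ('v, 'k::field) mpoly \<Rightarrow> ('v, 'k) mpoly" where
  "mscale c p = Const c * p"

lemma vector_space_mscale: "vector_space mscale"
  by unfold_locales
    (simp_all add: mscale_def Const_def single_add algebra_simps mult_single
      flip: mult.assoc)

text \<open>
  A commutative ring is a module over itself; its submodules are the ideals, and the span of a set
  is the ideal generated by it.
\<close>

lemma module_mult: "module ((*) :: 'a::comm_ring_1 \<Rightarrow> 'a \<Rightarrow> 'a)"
  by unfold_locales (simp_all add: algebra_simps)

definition ideal_gen :: "'a::comm_ring_1 set \<Rightarrow> 'a set" where
  "ideal_gen A = module.span (*) A"

definition ideal_mult :: "'a::comm_ring_1 set \<Rightarrow> 'a set \<Rightarrow> 'a set" where
  "ideal_mult I J = ideal_gen {a * b | a b. a \<in> I \<and> b \<in> J}"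

primrec ideal_power :: "'a::comm_ring_1 set \<Rightarrow> nat \<Rightarrow> 'a set" where
  "ideal_power I 0 = UNIV"
| "ideal_power I (Suc k) = ideal_mult I (ideal_power I k)"

definition primary_ideal :: "'a::comm_ring_1 set \<Rightarrow> bool" where
  "primary_ideal Q \<longleftrightarrow>
     module.subspace (*) Q \<and> Q \<noteq> UNIV \<and>
     (\<forall>a b. a * b \<in> Q \<longrightarrow> a \<in> Q \<or> (\<exists>k\<ge>1. b ^ k \<in> Q))"

definition fold_product_ideal :: "(nat \<Rightarrow> 'a::comm_ring_1) \<Rightarrow> nat \<Rightarrow> nat \<Rightarrow> 'a set" where
  "fold_product_ideal l n d = ideal_gen {\<Prod>i\<in>T. l i | T. T \<subseteq> {1..n} \<and> card T = d}"

definition arr_rank :: "(nat \<Rightarrow> ('v, 'k::field) mpoly) \<Rightarrow> nat set \<Rightarrow> nat" where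
  "arr_rank h S = vector_space.dim mscale (module.span mscale (h ` S))"

definition is_flat :: "(nat \<Rightarrow> ('v, 'k::field) mpoly) \<Rightarrow> nat \<Rightarrow> nat set \<Rightarrow> bool" where
  "is_flat h n S \<longleftrightarrow>
     S \<subseteq> {1..n} \<and> (\<forall>i\<in>{1..n} - S. arr_rank h (insert i S) > arr_rank h S)"

text \<open>The index set of the decomposition; \<open>Var None\<close> is the hyperplane at infinity.\<close>

definition decomposition_flats ::
    "(nat \<Rightarrow> ('v::finite, 'k::field) mpoly) \<Rightarrow> nat \<Rightarrow> nat \<Rightarrow> nat set set" where
  "decomposition_flats l n d =
     {S. is_flat (\<lambda>i. homogenization (l i)) n S \<and>
         Var None \<notin> ideal_gen ((\<lambda>i. homogenization (l i)) ` S) \<and>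
         card S \<ge> n - d + 1}"

end

theory Submission
  imports Defs
begin

text \<open>
  It suffices to intersect over all subsets \<open>S\<close> of the index set: passing from \<open>S\<close> to its closure
  keeps the ideal and raises the exponent, and the closures whose span contains the hyperplane at
  infinity give the unit ideal. The equality is then proved by induction on the number of forms,
  for arbitrary polynomials of degree at most one. Let \<open>f\<close> lie in the intersection and let \<open>e\<close> be one
  of the forms. If \<open>e = 0\<close> it can be dropped, and if \<open>e\<close> is a unit then \<open>f\<close> is already a
  combination of \<open>(d - 1)\<close>-fold products of the other forms. Otherwise a substitution that kills
  \<open>e\<close> and is the identity modulo \<open>e\<close> yields, by induction, \<open>f = g + e h\<close> with \<open>g\<close> in the ideal of
  \<open>d\<close>-fold products of the other forms. Each proper \<open>I\<^sub>S\<close> becomes an ideal of variables after an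
  affine change of coordinates, so its powers are governed by a valuation. Hence \<open>e h\<close> lying in the
  intersection forces \<open>h\<close> into the intersection for the other forms and \<open>d - 1\<close>, and the
  induction hypothesis applies to \<open>h\<close>.
\<close>

section \<open>Ideals and their powers\<close>

interpretation ideal: module "(*) :: 'a::comm_ring_1 \<Rightarrow> 'a \<Rightarrow> 'a"
  by (rule module_mult)

text \<open>For a ring acting on itself this rule undoes \<open>mult.assoc\<close>, and simplification loops.\<close>

declare ideal.scale_scale [simp del]

interpretation mscale: vector_space "mscale :: 'k::field \<Rightarrow> ('v, 'k) mpoly \<Rightarrow> ('v, 'k) mpoly"
  by (rule vector_space_mscale)

lemma subspace_ideal_gen [simp, intro]: "ideal.subspace (ideal_gen A)"
  by (simp add: ideal_gen_def)

lemma ideal_gen_base: "a \<in> A \<Longrightarrow> a \<in> ideal_gen A"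
  by (simp add: ideal_gen_def ideal.span_base)

lemma ideal_gen_minimal: "A \<subseteq> J \<Longrightarrow> ideal.subspace J \<Longrightarrow> ideal_gen A \<subseteq> J"
  by (simp add: ideal_gen_def ideal.span_minimal)

lemma ideal_gen_mono: "A \<subseteq> B \<Longrightarrow> ideal_gen A \<subseteq> ideal_gen B"
  by (simp add: ideal_gen_def ideal.span_mono)

lemma ideal_gen_eqI: "A \<subseteq> ideal_gen B \<Longrightarrow> B \<subseteq> ideal_gen A \<Longrightarrow> ideal_gen A = ideal_gen B"
  by (simp add: ideal_gen_minimal subset_antisym)

lemma mscale_span_subset_ideal_gen: "mscale.span A \<subseteq> ideal_gen A"
proof (rule mscale.span_minimal)
  show "A \<subseteq> ideal_gen A" using ideal_gen_base by blast
  show "mscale.subspace (ideal_gen A)"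
    by (auto simp: mscale.subspace_def mscale_def ideal.subspace_0 ideal.subspace_add
        ideal.subspace_scale)
qed

text \<open>Constants are polynomials, so every ideal is a \<open>'k\<close>-subspace and contains
  the \<open>'k\<close>-span of its generators. Hence linear algebra may be done on generating sets
  without changing the ideal.\<close>

lemma ideal_gen_mscale_span_cong:
  assumes "mscale.span A = mscale.span B"
  shows "ideal_gen A = ideal_gen B"
proof (rule ideal_gen_eqI)
  show "A \<subseteq> ideal_gen B" "B \<subseteq> ideal_gen A"
    using assms mscale_span_subset_ideal_gen[of A] mscale_span_subset_ideal_gen[of B]
      mscale.span_superset[of A] mscale.span_superset[of B] by blast+
qed

lemma ideal_eq_UNIV_iff: "ideal.subspace J \<Longrightarrow> J = UNIV \<longleftrightarrow> 1 \<in> J"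
  using ideal.subspace_scale[of J 1] by auto

lemma ideal_mult_right: "ideal.subspace J \<Longrightarrow> x \<in> J \<Longrightarrow> x * c \<in> J"
  using ideal.subspace_scale[of J x c] by (simp add: mult.commute)

text \<open>With this colon ideal, a claim about multiplication by \<open>a\<close> need only be
  checked on generators.\<close>

lemma subspace_colon:
  assumes "ideal.subspace J"
  shows "ideal.subspace {g. a * g \<in> J}"
proof -
  have "a * (c * x) \<in> J" if "a * x \<in> J" for c x
    using ideal.subspace_scale[OF assms that, of c] by (simp add: mult.left_commute)
  then show ?thesis
    using assms unfolding ideal.subspace_def by (simp add: distrib_left)
qed

lemma subspace_ideal_power [simp, intro]: "ideal.subspace (ideal_power I k)"
  by (cases k) (auto simp: ideal_mult_def)

lemma ideal_power_SucI: "a \<in> I \<Longrightarrow> b \<in> ideal_power I k \<Longrightarrow> a * b \<in> ideal_power I (Suc k)"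
  by (auto simp: ideal_mult_def intro!: ideal_gen_base)

lemma ideal_power_Suc_minimal:
  assumes "ideal.subspace J" and "\<And>a b. a \<in> I \<Longrightarrow> b \<in> ideal_power I k \<Longrightarrow> a * b \<in> J"
  shows "ideal_power I (Suc k) \<subseteq> J"
  unfolding ideal_power.simps ideal_mult_def
  by (rule ideal_gen_minimal) (use assms in auto)

lemma ideal_power_antimono:
  assumes "j \<le> k"
  shows "ideal_power I k \<subseteq> ideal_power I j"
  using assms
proof (induction rule: dec_induct)
  case (step m)
  have "ideal_power I (Suc m) \<subseteq> ideal_power I m"
    by (rule ideal_power_Suc_minimal) (auto intro: ideal.subspace_scale)
  with step.IH show ?case by blast
qed simp

lemma ideal_power_UNIV [simp]: "ideal_power UNIV k = (UNIV :: 'a::comm_ring_1 set)"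
proof (induction k)
  case (Suc k)
  have "1 * 1 \<in> ideal_power (UNIV :: 'a set) (Suc k)"
    by (rule ideal_power_SucI) (simp_all only: Suc UNIV_I)
  then show ?case
    by (simp only: ideal_eq_UNIV_iff[OF subspace_ideal_power] mult_1_left)
qed simp

lemma power_in_ideal_power: "b \<in> I \<Longrightarrow> b ^ k \<in> ideal_power I k"
  by (induction k) (auto simp del: ideal_power.simps(2) intro: ideal_power_SucI)

lemma prod_in_ideal_power:
  "finite T \<Longrightarrow> (\<And>i. i \<in> T \<Longrightarrow> l i \<in> I) \<Longrightarrow> (\<Prod>i\<in>T. l i) \<in> ideal_power I (card T)"
  by (induction T rule: finite_induct)
    (auto simp del: ideal_power.simps(2) intro: ideal_power_SucI)

section \<open>Ring homomorphisms and images of ideals and their powers\<close>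

locale ring_map =
  fixes \<phi> :: "'a::comm_ring_1 \<Rightarrow> 'b::comm_ring_1"
  assumes add: "\<phi> (x + y) = \<phi> x + \<phi> y"
    and mult: "\<phi> (x * y) = \<phi> x * \<phi> y"
    and one: "\<phi> 1 = 1"
begin

lemma zero: "\<phi> 0 = 0"
  using add[of 0 0] by simp

lemma sum: "\<phi> (\<Sum>i\<in>A. f i) = (\<Sum>i\<in>A. \<phi> (f i))"
  by (induction A rule: infinite_finite_induct) (simp_all add: add zero)

lemma prod: "\<phi> (\<Prod>i\<in>A. f i) = (\<Prod>i\<in>A. \<phi> (f i))"
  by (induction A rule: infinite_finite_induct) (simp_all add: mult one)

lemma subspace_vimage: "ideal.subspace J \<Longrightarrow> ideal.subspace {x. \<phi> x \<in> J}"
  by (auto simp: ideal.subspace_def add mult zero)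

lemma in_ideal_gen_image: "x \<in> ideal_gen A \<Longrightarrow> \<phi> x \<in> ideal_gen (\<phi> ` A)"
  using ideal_gen_minimal[OF _ subspace_vimage[OF subspace_ideal_gen], of A "\<phi> ` A"]
  by (auto simp: ideal_gen_base subset_iff)

lemma in_ideal_power_image:
  assumes "\<And>x. x \<in> I \<Longrightarrow> \<phi> x \<in> J"
  shows "x \<in> ideal_power I k \<Longrightarrow> \<phi> x \<in> ideal_power J k"
proof (induction k arbitrary: x)
  case (Suc k)
  have "ideal_power I (Suc k) \<subseteq> {x. \<phi> x \<in> ideal_power J (Suc k)}"
  proof (rule ideal_power_Suc_minimal)
    show "ideal.subspace {x. \<phi> x \<in> ideal_power J (Suc k)}"
      by (rule subspace_vimage) (rule subspace_ideal_power)
    fix a b assume "a \<in> I" "b \<in> ideal_power I k"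
    then show "a * b \<in> {x. \<phi> x \<in> ideal_power J (Suc k)}"
      using assms Suc.IH by (simp add: mult ideal_power_SucI del: ideal_power.simps)
  qed
  with Suc.prems show ?case by blast
qed simp

end

section \<open>Substitution in polynomials\<close>

lemma Const_0 [simp]: "Const 0 = 0"
  and Const_1 [simp]: "Const 1 = 1"
  by (simp_all add: Const_def)

lemma Const_add: "Const (a + b) = Const a + Const b"
  and Const_mult: "Const (a * b) = Const a * Const b"
  and Const_uminus: "Const (- a) = - Const a"
  by (simp_all add: Const_def single_add mult_single single_uminus)

lemma Const_mult_single: "Const c * Poly_Mapping.single m a = Poly_Mapping.single m (c * a)"
  by (simp add: Const_def mult_single)

text \<open>The extra summands are zero; the slack in \<open>X\<close> lets sums run over all
  variables or all monomials of degree at most one.\<close>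

lemma poly_mapping_sum_singles:
  assumes "finite X" "Poly_Mapping.keys p \<subseteq> X"
  shows "p = (\<Sum>m\<in>X. Poly_Mapping.single m (Poly_Mapping.lookup p m))"
proof (rule poly_mapping_eqI)
  fix k
  have "(\<Sum>m\<in>X. Poly_Mapping.lookup (Poly_Mapping.single m (Poly_Mapping.lookup p m)) k) =
    (\<Sum>m\<in>X. if m = k then Poly_Mapping.lookup p k else 0)"
    by (intro sum.cong) (auto simp: lookup_single)
  then show "Poly_Mapping.lookup p k =
    Poly_Mapping.lookup (\<Sum>m\<in>X. Poly_Mapping.single m (Poly_Mapping.lookup p m)) k"
    using assms by (auto simp: lookup_sum in_keys_iff)
qed

lemma lookup_mult_keys:
  "Poly_Mapping.lookup (p * q) k =
     (\<Sum>m\<in>Poly_Mapping.keys p. \<Sum>n\<in>Poly_Mapping.keys q.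
        if m + n = k then Poly_Mapping.lookup p m * Poly_Mapping.lookup q n else 0)"
proof -
  have "p * q = (\<Sum>m\<in>Poly_Mapping.keys p. \<Sum>n\<in>Poly_Mapping.keys q.
      Poly_Mapping.single (m + n) (Poly_Mapping.lookup p m * Poly_Mapping.lookup q n))"
    by (subst poly_mapping_sum_singles[of "Poly_Mapping.keys p" p, OF _ order_refl],
        simp, subst poly_mapping_sum_singles[of "Poly_Mapping.keys q" q, OF _ order_refl],
        simp, simp only: sum_product mult_single)
  then show ?thesis
    by (auto simp: lookup_sum lookup_single when_def intro!: sum.cong)
qed

lemma Var_power: "(Var v :: ('v, 'k::field) mpoly) ^ k = Poly_Mapping.single (Poly_Mapping.single v k) 1"
  by (induction k) (simp_all add: Var_def mult_single flip: single_add)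

lemma single_as_prod_Var:
  fixes c :: "'k::field" and m :: "'v::finite \<Rightarrow>\<^sub>0 nat"
  shows "Poly_Mapping.single m c = Const c * (\<Prod>v\<in>UNIV. Var v ^ Poly_Mapping.lookup m v)"
proof -
  have "(\<Prod>v\<in>A. (Var v :: ('v, 'k) mpoly) ^ Poly_Mapping.lookup m v) =
    Poly_Mapping.single (\<Sum>v\<in>A. Poly_Mapping.single v (Poly_Mapping.lookup m v)) 1" if "finite A" for A
    using that by induction (simp_all add: Var_power mult_single)
  moreover have "m = (\<Sum>v\<in>UNIV. Poly_Mapping.single v (Poly_Mapping.lookup m v))"
    by (rule poly_mapping_sum_singles) auto
  ultimately show ?thesis
    by (simp add: Const_mult_single)
qed

text \<open>Constants and variables generate the polynomial ring as a ring.\<close>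

lemma mpoly_induct [case_names Const Var add mult]:
  fixes p :: "('v::finite, 'k::field) mpoly"
  assumes "\<And>c. P (Const c)" "\<And>v. P (Var v)"
    and add: "\<And>p q. P p \<Longrightarrow> P q \<Longrightarrow> P (p + q)" and mult: "\<And>p q. P p \<Longrightarrow> P q \<Longrightarrow> P (p * q)"
  shows "P p"
proof -
  have one: "P 1" and zero: "P 0"
    using assms(1)[of 1] assms(1)[of 0] by simp_all
  have power: "P (Var v ^ k)" for v k
    by (induction k) (simp_all add: one assms)
  have prod: "P (\<Prod>v\<in>A. Var v ^ f v)" if "finite A" for A f
    using that by induction (simp_all add: one mult power)
  have single: "P (Poly_Mapping.single m c)" for m c
    unfolding single_as_prod_Var by (intro mult assms prod) simp
  have "P (\<Sum>m\<in>X. Poly_Mapping.single m (Poly_Mapping.lookup p m))" if "finite X" for X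
    using that by (induction X rule: finite_induct) (simp_all add: zero add single)
  then show ?thesis
    by (subst poly_mapping_sum_singles[of "Poly_Mapping.keys p" p]) simp_all
qed

text \<open>The evaluation homomorphism. The target may have other variables, as dehomogenization
  requires.\<close>

definition mpoly_subst :: "('v::finite \<Rightarrow> ('w, 'k::field) mpoly) \<Rightarrow> ('v, 'k) mpoly \<Rightarrow> ('w, 'k) mpoly"
  where "mpoly_subst \<sigma> p =
    (\<Sum>m\<in>Poly_Mapping.keys p. Const (Poly_Mapping.lookup p m) * (\<Prod>v\<in>UNIV. \<sigma> v ^ Poly_Mapping.lookup m v))"

text \<open>Cancellation can make the support of a sum smaller than the union of the supports, so
  additivity needs a common index set on which the extra coefficients vanish.\<close>

lemma mpoly_subst_superset:
  assumes "finite X" "Poly_Mapping.keys p \<subseteq> X"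
  shows "mpoly_subst \<sigma> p =
    (\<Sum>m\<in>X. Const (Poly_Mapping.lookup p m) * (\<Prod>v\<in>UNIV. \<sigma> v ^ Poly_Mapping.lookup m v))"
  unfolding mpoly_subst_def using assms
  by (intro sum.mono_neutral_left) (auto simp: in_keys_iff)

lemma mpoly_subst_add: "mpoly_subst \<sigma> (p + q) = mpoly_subst \<sigma> p + mpoly_subst \<sigma> q"
proof -
  let ?X = "Poly_Mapping.keys p \<union> Poly_Mapping.keys q"
  have "Poly_Mapping.keys (p + q) \<subseteq> ?X"
    by (rule keys_add)
  then show ?thesis
    by (simp add: mpoly_subst_superset[of ?X] lookup_add Const_add distrib_right sum.distrib)
qed

lemma mpoly_subst_single:
  "mpoly_subst \<sigma> (Poly_Mapping.single m c) = Const c * (\<Prod>v\<in>UNIV. \<sigma> v ^ Poly_Mapping.lookup m v)"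
  by (simp add: mpoly_subst_superset[of "{m}"])

lemma mpoly_subst_Const [simp]: "mpoly_subst \<sigma> (Const c) = Const c"
  using mpoly_subst_single[of \<sigma> 0 c] by (simp add: Const_def)

lemma mpoly_subst_Var [simp]: "mpoly_subst \<sigma> (Var v) = \<sigma> v"
proof -
  have "(\<Prod>u\<in>UNIV. \<sigma> u ^ Poly_Mapping.lookup (Poly_Mapping.single v 1) u) =
    (\<Prod>u\<in>UNIV. if u = v then \<sigma> u else 1)"
    by (intro prod.cong) (auto simp: lookup_single)
  then show ?thesis
    by (simp add: Var_def mpoly_subst_single)
qed

lemma mpoly_subst_sum: "mpoly_subst \<sigma> (\<Sum>i\<in>A. f i) = (\<Sum>i\<in>A. mpoly_subst \<sigma> (f i))"
  by (induction A rule: infinite_finite_induct)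
    (simp_all add: mpoly_subst_add mpoly_subst_def[of _ 0])

lemma mpoly_subst_mult: "mpoly_subst \<sigma> (p * q) = mpoly_subst \<sigma> p * mpoly_subst \<sigma> q"
proof -
  have single: "mpoly_subst \<sigma> (Poly_Mapping.single m a * Poly_Mapping.single n b) =
    mpoly_subst \<sigma> (Poly_Mapping.single m a) * mpoly_subst \<sigma> (Poly_Mapping.single n b)" for m a n b
    by (simp add: mult_single mpoly_subst_single lookup_add power_add prod.distrib Const_mult)
  define P where "P = (\<lambda>m. Poly_Mapping.single m (Poly_Mapping.lookup p m))"
  define Q where "Q = (\<lambda>m. Poly_Mapping.single m (Poly_Mapping.lookup q m))"
  have p: "p = sum P (Poly_Mapping.keys p)" and q: "q = sum Q (Poly_Mapping.keys q)"
    unfolding P_def Q_def by (rule poly_mapping_sum_singles; simp)+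
  have "mpoly_subst \<sigma> (sum P (Poly_Mapping.keys p) * sum Q (Poly_Mapping.keys q)) =
      mpoly_subst \<sigma> (sum P (Poly_Mapping.keys p)) * mpoly_subst \<sigma> (sum Q (Poly_Mapping.keys q))"
    by (simp add: sum_product mpoly_subst_sum P_def Q_def single)
  then show ?thesis
    by (simp flip: p q)
qed

lemma ring_map_mpoly_subst: "ring_map (mpoly_subst \<sigma>)"
  using mpoly_subst_Const[of \<sigma> 1]
  by unfold_locales (simp_all add: mpoly_subst_add mpoly_subst_mult del: mpoly_subst_Const)

section \<open>Algebra homomorphisms over the field and images of spans\<close>

locale algebra_map = ring_map \<phi>
  for \<phi> :: "('v, 'k::field) mpoly \<Rightarrow> ('w, 'k) mpoly" +
  assumes Const: "\<phi> (Const c) = Const c"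
begin

lemma in_span_image: "x \<in> mscale.span A \<Longrightarrow> \<phi> x \<in> mscale.span (\<phi> ` A)"
proof (induction rule: mscale.span_induct_alt)
  case base
  show ?case by (simp add: zero mscale.span_zero)
next
  case (step c x y)
  have "\<phi> (mscale c x + y) = mscale c (\<phi> x) + \<phi> y"
    by (simp add: mscale_def add mult Const)
  with step show ?case
    by (simp add: mscale.span_add mscale.span_scale mscale.span_base)
qed

lemma span_image_cong:
  assumes "mscale.span A = mscale.span B"
  shows "mscale.span (\<phi> ` A) = mscale.span (\<phi> ` B)"
proof -
  have "A \<subseteq> mscale.span B" "B \<subseteq> mscale.span A"
    using assms mscale.span_superset[of A] mscale.span_superset[of B] by blast+
  then show ?thesis
    using in_span_image by (auto simp: mscale.span_eq)
qed

end

lemma algebra_map_mpoly_subst: "algebra_map (mpoly_subst \<sigma>)"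
  by (intro algebra_map.intro ring_map_mpoly_subst algebra_map_axioms.intro mpoly_subst_Const)

lemma algebra_map_compose: "algebra_map f \<Longrightarrow> algebra_map g \<Longrightarrow> algebra_map (\<lambda>x. f (g x))"
  by (simp add: algebra_map_def algebra_map_axioms_def ring_map_def)

lemma mpoly_subst_inverse:
  assumes "\<And>v. mpoly_subst \<sigma> (\<tau> v) = Var v"
  shows "mpoly_subst \<sigma> (mpoly_subst \<tau> p) = p"
  by (induction p rule: mpoly_induct) (simp_all add: assms mpoly_subst_add mpoly_subst_mult)

text \<open>Congruence modulo \<open>e\<close> is compatible with sums and products, so it spreads
  from the variables to all polynomials.\<close>

lemma dvd_mpoly_subst_diff:
  assumes "\<And>v. e dvd \<sigma> v - Var v"
  shows "e dvd mpoly_subst \<sigma> p - p"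
proof (induction p rule: mpoly_induct)
  case (add p q)
  have "mpoly_subst \<sigma> (p + q) - (p + q) = (mpoly_subst \<sigma> p - p) + (mpoly_subst \<sigma> q - q)"
    by (simp add: mpoly_subst_add)
  with add show ?case by (metis dvd_add)
next
  case (mult p q)
  have "mpoly_subst \<sigma> (p * q) - p * q =
      (mpoly_subst \<sigma> p - p) * mpoly_subst \<sigma> q + p * (mpoly_subst \<sigma> q - q)"
    by (simp add: mpoly_subst_mult algebra_simps)
  with mult show ?case by (metis dvd_add dvd_mult dvd_mult2)
qed (simp_all add: assms)

section \<open>The valuation of an ideal of variables\<close>

text \<open>The polynomials of order at least \<open>k\<close> along the coordinate subspace where
  the variables in \<open>A\<close> vanish.\<close>

definition order_ideal :: "'v set \<Rightarrow> nat \<Rightarrow> ('v, 'k::field) mpoly set" where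
  "order_ideal A k = {p. \<forall>m\<in>Poly_Mapping.keys p. k \<le> (\<Sum>v\<in>A. Poly_Mapping.lookup m v)}"

lemma subspace_order_ideal:
  "ideal.subspace (order_ideal A k :: ('v, 'k::field) mpoly set)"
proof -
  have "c * x \<in> order_ideal A k" if x: "x \<in> order_ideal A k" for c x :: "('v, 'k) mpoly"
  proof -
    have "k \<le> (\<Sum>v\<in>A. Poly_Mapping.lookup m v)" if "m \<in> Poly_Mapping.keys (c * x)" for m
    proof -
      obtain a b where "m = a + b" "b \<in> Poly_Mapping.keys x"
        using \<open>m \<in> _\<close> keys_mult[of c x] by blast
      then show ?thesis
        using x by (auto simp: order_ideal_def lookup_add sum.distrib intro: trans_le_add2)
    qed
    then show ?thesis by (simp add: order_ideal_def)
  qed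
  moreover have "x + y \<in> order_ideal A k" if "x \<in> order_ideal A k" "y \<in> order_ideal A k"
    for x y :: "('v, 'k) mpoly"
    using that keys_add[of x y] by (auto simp: order_ideal_def)
  moreover have "0 \<in> (order_ideal A k :: ('v, 'k) mpoly set)"
    by (simp add: order_ideal_def)
  ultimately show ?thesis
    unfolding ideal.subspace_def by blast
qed

lemma order_ideal_mult:
  assumes "p \<in> order_ideal A i" "q \<in> order_ideal A j"
  shows "p * q \<in> order_ideal A (i + j)"
proof -
  have "i + j \<le> (\<Sum>v\<in>A. Poly_Mapping.lookup m v)" if "m \<in> Poly_Mapping.keys (p * q)" for m
  proof -
    obtain a b where "m = a + b" "a \<in> Poly_Mapping.keys p" "b \<in> Poly_Mapping.keys q"
      using \<open>m \<in> _\<close> keys_mult[of p q] by blast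
    then show ?thesis
      using assms by (auto simp: order_ideal_def lookup_add sum.distrib intro: add_mono)
  qed
  then show ?thesis by (simp add: order_ideal_def)
qed

text \<open>Induction on \<open>k\<close> splits one variable of \<open>A\<close> off the monomial
  at a time.\<close>

lemma single_in_power_Var_ideal:
  fixes A :: "'v::finite set" and c :: "'k::field"
  assumes "k \<le> (\<Sum>v\<in>A. Poly_Mapping.lookup m v)"
  shows "Poly_Mapping.single m c \<in> ideal_power (ideal_gen (Var ` A)) k"
  using assms
proof (induction k arbitrary: m)
  case (Suc k)
  have "(\<Sum>v\<in>A. Poly_Mapping.lookup m v) \<noteq> 0" using Suc.prems by linarith
  then obtain a where a: "a \<in> A" "Poly_Mapping.lookup m a \<noteq> 0"
    by (meson sum.neutral)
  \<comment> \<open>Subtraction of exponents is truncated; \<open>m\<close> is recovered from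
    \<open>n\<close> because the exponent of \<open>a\<close> is nonzero.\<close>
  define n where "n = m - Poly_Mapping.single a 1"
  have m: "m = Poly_Mapping.single a 1 + n"
  proof (rule poly_mapping_eqI)
    fix v show "Poly_Mapping.lookup m v = Poly_Mapping.lookup (Poly_Mapping.single a 1 + n) v"
      using a(2) by (auto simp add: n_def lookup_add minus_poly_mapping.rep_eq lookup_single when_def)
  qed
  have "(\<Sum>v\<in>A. Poly_Mapping.lookup m v) =
      (\<Sum>v\<in>A. if v = a then 1 else 0) + (\<Sum>v\<in>A. Poly_Mapping.lookup n v)"
    unfolding sum.distrib[symmetric]
    by (rule sum.cong) (auto simp: m lookup_add lookup_single when_def)
  also have "\<dots> = Suc (\<Sum>v\<in>A. Poly_Mapping.lookup n v)"
    using a(1) by simp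
  finally have "Poly_Mapping.single n c \<in> ideal_power (ideal_gen (Var ` A)) k"
    using Suc by simp
  moreover have "Poly_Mapping.single m c = Var a * Poly_Mapping.single n c"
    by (simp add: m Var_def mult_single)
  ultimately show ?case
    using a(1) by (metis ideal_power_SucI ideal_gen_base imageI)
qed simp

lemma power_Var_ideal:
  "ideal_power (ideal_gen (Var ` A)) k = (order_ideal A k :: ('v::finite, 'k::field) mpoly set)"
proof
  show "ideal_power (ideal_gen (Var ` A)) k \<subseteq> (order_ideal A k :: ('v, 'k) mpoly set)"
  proof (induction k)
    case 0
    then show ?case by (simp add: order_ideal_def)
  next
    case (Suc k)
    have "Var a \<in> order_ideal A 1" if "a \<in> A" for a
    proof -
      have "(\<Sum>v\<in>A. Poly_Mapping.lookup (Poly_Mapping.single a (1::nat)) v) =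
          (\<Sum>v\<in>A. if v = a then 1 else 0)"
        by (rule sum.cong) (auto simp: lookup_single when_def)
      with that show ?thesis by (simp add: order_ideal_def Var_def)
    qed
    then have "ideal_gen (Var ` A) \<subseteq> (order_ideal A 1 :: ('v, 'k) mpoly set)"
      by (intro ideal_gen_minimal subspace_order_ideal) auto
    with Suc order_ideal_mult[of _ A 1 _ k] show ?case
      by (intro ideal_power_Suc_minimal subspace_order_ideal) auto
  qed
  show "order_ideal A k \<subseteq> (ideal_power (ideal_gen (Var ` A)) k :: ('v, 'k) mpoly set)"
  proof
    fix p :: "('v, 'k) mpoly" assume p: "p \<in> order_ideal A k"
    have "(\<Sum>m\<in>Poly_Mapping.keys p. Poly_Mapping.single m (Poly_Mapping.lookup p m))
        \<in> ideal_power (ideal_gen (Var ` A)) k"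
      by (intro ideal.subspace_sum subspace_ideal_power single_in_power_Var_ideal)
        (use p in \<open>simp add: order_ideal_def\<close>)
    then show "p \<in> ideal_power (ideal_gen (Var ` A)) k"
      by (subst poly_mapping_sum_singles[of "Poly_Mapping.keys p" p]) simp_all
  qed
qed

section \<open>Additivity of the order\<close>

lemma ex_lex_minimal:
  fixes f :: "'a \<Rightarrow> 'b::linorder" and e :: "'a \<Rightarrow> 'c::linorder"
  assumes "finite X" "X \<noteq> {}"
  obtains m where "m \<in> X" "\<And>n. n \<in> X \<Longrightarrow> f m \<le> f n"
    "\<And>n. n \<in> X \<Longrightarrow> f n = f m \<Longrightarrow> e m \<le> e n"
proof -
  define Y where "Y = {m \<in> X. f m = Min (f ` X)}"
  have Y: "finite Y" "Y \<noteq> {}"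
    using assms Min_in[of "f ` X"] by (auto simp: Y_def image_iff)
  then have "Min (e ` Y) \<in> e ` Y" by (intro Min_in) auto
  then obtain m where m: "m \<in> Y" "e m = Min (e ` Y)" by auto
  show thesis
  proof
    show "m \<in> X" using m by (simp add: Y_def)
    show "f m \<le> f n" if "n \<in> X" for n
      using m that assms by (simp add: Y_def)
    show "e m \<le> e n" if "n \<in> X" "f n = f m" for n
      using m that Y by (simp add: Y_def)
  qed
qed

text \<open>
  Comparing monomials first by \<open>A\<close>-degree and then by any additive linear order, the least
  monomials of the two factors contribute the only term of their product monomial.
\<close>

lemma order_ideal_mult_notin:
  fixes p q :: "('v::finite, 'k::field) mpoly"
  assumes p: "p \<notin> order_ideal A (Suc i)" and q: "q \<notin> order_ideal A (Suc j)"
  shows "p * q \<notin> order_ideal A (Suc (i + j))"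
proof -
  define D where "D m = (\<Sum>v\<in>A. Poly_Mapping.lookup m v)" for m :: "'v \<Rightarrow>\<^sub>0 nat"
  have D_add: "D (m + n) = D m + D n" for m n
    by (simp add: D_def lookup_add sum.distrib)
  \<comment> \<open>The type of variables carries no order. Numbering the variables embeds exponent
    vectors additively, by \<open>e\<close>, into finitely supported maps on the naturals, whose
    linear order is compatible with addition.\<close>
  obtain idx :: "'v \<Rightarrow> nat" where idx: "inj idx"
    using finite_imp_inj_to_nat_seg[of "UNIV :: 'v set"] by auto
  define e where "e m = (\<Sum>v\<in>UNIV. Poly_Mapping.single (idx v) (Poly_Mapping.lookup m v))"
    for m :: "'v \<Rightarrow>\<^sub>0 nat"
  have e_add: "e (m + n) = e m + e n" for m n
    by (simp add: e_def lookup_add single_add sum.distrib)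
  have lookup_e: "Poly_Mapping.lookup (e m) (idx v) = Poly_Mapping.lookup m v" for m v
  proof -
    have "Poly_Mapping.lookup (e m) (idx v) =
        (\<Sum>u\<in>UNIV. if u = v then Poly_Mapping.lookup m v else 0)"
      unfolding e_def lookup_sum
      by (rule sum.cong) (use idx in \<open>auto simp: lookup_single when_def inj_eq\<close>)
    then show ?thesis by simp
  qed
  have e_inj: "m = n" if "e m = e n" for m n
    by (rule poly_mapping_eqI) (metis lookup_e that)
  obtain m' where m': "m' \<in> Poly_Mapping.keys p" "D m' \<le> i"
    using p by (auto simp: order_ideal_def D_def not_less_eq_eq)
  obtain n' where n': "n' \<in> Poly_Mapping.keys q" "D n' \<le> j"
    using q by (auto simp: order_ideal_def D_def not_less_eq_eq)
  obtain m0 where m0: "m0 \<in> Poly_Mapping.keys p" "\<And>m. m \<in> Poly_Mapping.keys p \<Longrightarrow> D m0 \<le> D m"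
    "\<And>m. m \<in> Poly_Mapping.keys p \<Longrightarrow> D m = D m0 \<Longrightarrow> e m0 \<le> e m"
    using ex_lex_minimal[of "Poly_Mapping.keys p" D e] m'(1) finite_keys by blast
  obtain n0 where n0: "n0 \<in> Poly_Mapping.keys q" "\<And>m. m \<in> Poly_Mapping.keys q \<Longrightarrow> D n0 \<le> D m"
    "\<And>m. m \<in> Poly_Mapping.keys q \<Longrightarrow> D m = D n0 \<Longrightarrow> e n0 \<le> e m"
    using ex_lex_minimal[of "Poly_Mapping.keys q" D e] n'(1) finite_keys by blast
  \<comment> \<open>In a competing pair both \<open>D\<close>-degrees are minimal, since their sums
    agree; the tie-break \<open>e\<close> then forces the chosen monomials.\<close>
  have unique: "m + n = m0 + n0 \<longleftrightarrow> m = m0 \<and> n = n0"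
    if mn: "m \<in> Poly_Mapping.keys p" "n \<in> Poly_Mapping.keys q" for m n
  proof
    assume eq: "m + n = m0 + n0"
    then have "D m + D n = D m0 + D n0" by (metis D_add)
    with m0(2)[OF mn(1)] n0(2)[OF mn(2)] have "D m = D m0" "D n = D n0" by linarith+
    then have le: "e m0 \<le> e m" "e n0 \<le> e n"
      using m0(3) n0(3) mn by blast+
    have sum: "e m + e n = e m0 + e n0" using eq by (metis e_add)
    have "e m = e m0"
    proof (rule ccontr)
      assume "e m \<noteq> e m0"
      with le have "e m0 + e n0 < e m + e n"
        by (intro add_less_le_mono) auto
      with sum show False by simp
    qed
    with eq show "m = m0 \<and> n = n0" using e_inj[of m m0] by simp
  qed simp
  \<comment> \<open>Only the pair \<open>m0\<close>, \<open>n0\<close> contributes, so the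
    coefficient is a product of two nonzero field elements.\<close>
  have "Poly_Mapping.lookup (p * q) (m0 + n0) =
      (\<Sum>m\<in>Poly_Mapping.keys p. \<Sum>n\<in>Poly_Mapping.keys q.
        if m = m0 then if n = n0 then Poly_Mapping.lookup p m * Poly_Mapping.lookup q n else 0 else 0)"
    unfolding lookup_mult_keys by (intro sum.cong refl) (simp add: unique)
  also have "\<dots> = (\<Sum>m\<in>Poly_Mapping.keys p.
      if m = m0 then Poly_Mapping.lookup p m * Poly_Mapping.lookup q n0 else 0)"
    by (intro sum.cong refl) (use n0(1) in auto)
  also have "\<dots> = Poly_Mapping.lookup p m0 * Poly_Mapping.lookup q n0"
    using m0(1) by simp
  also have "\<dots> \<noteq> 0" using m0(1) n0(1) by (simp add: in_keys_iff)
  finally have "m0 + n0 \<in> Poly_Mapping.keys (p * q)" by (simp add: in_keys_iff)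
  moreover have "D (m0 + n0) \<le> i + j"
    using m0(2)[OF m'(1)] m'(2) n0(2)[OF n'(1)] n'(2) by (simp add: D_add)
  ultimately show ?thesis
    by (auto simp: order_ideal_def D_def not_less_eq_eq)
qed

section \<open>Ideals generated by affine polynomials\<close>

definition affine_poly :: "('v::finite, 'k::field) mpoly \<Rightarrow> bool" where
  "affine_poly p \<longleftrightarrow> (\<forall>m\<in>Poly_Mapping.keys p. (\<Sum>v\<in>UNIV. Poly_Mapping.lookup m v) \<le> 1)"

lemma linear_poly_imp_affine_poly: "linear_poly p \<Longrightarrow> affine_poly p"
proof -
  assume p: "linear_poly p"
  have "(\<Sum>v\<in>UNIV. Poly_Mapping.lookup m v) \<le> 1" if "m \<in> Poly_Mapping.keys p" for m
  proof -
    have "total_degree p = 1" using p that by (auto simp: linear_poly_def)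
    then show ?thesis
      unfolding total_degree_def using that by (metis (no_types, lifting) Max_ge finite_imageI
          finite_insert finite_keys imageI insertCI)
  qed
  then show ?thesis by (simp add: affine_poly_def)
qed

lemma monomial_degree_le_1:
  fixes m :: "'v::finite \<Rightarrow>\<^sub>0 nat"
  assumes "(\<Sum>v\<in>UNIV. Poly_Mapping.lookup m v) \<le> 1"
  shows "m = 0 \<or> (\<exists>v. m = Poly_Mapping.single v 1)"
proof (cases "m = 0")
  case False
  then obtain v where v: "Poly_Mapping.lookup m v \<noteq> 0"
    by (metis lookup_zero poly_mapping_eqI)
  have "(\<Sum>u\<in>UNIV. Poly_Mapping.lookup m u) =
      Poly_Mapping.lookup m v + (\<Sum>u\<in>UNIV - {v}. Poly_Mapping.lookup m u)"
    by (rule sum.remove) auto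
  with assms v have "Poly_Mapping.lookup m v = 1" "(\<Sum>u\<in>UNIV - {v}. Poly_Mapping.lookup m u) = 0"
    by linarith+
  then have "m = Poly_Mapping.single v 1"
    by (intro poly_mapping_eqI) (auto simp: lookup_single when_def)
  then show ?thesis by blast
qed simp

text \<open>Degree at most one leaves only the constant monomial and the single variables, which are
  pairwise distinct.\<close>

lemma affine_poly_expansion:
  fixes p :: "('v::finite, 'k::field) mpoly"
  assumes "affine_poly p"
  shows "p = Const (Poly_Mapping.lookup p 0) +
    (\<Sum>v\<in>UNIV. Const (Poly_Mapping.lookup p (Poly_Mapping.single v 1)) * Var v)"
proof -
  let ?x = "\<lambda>v::'v. Poly_Mapping.single v (1::nat)"
  have inj: "inj ?x"
  proof (rule injI)
    fix u v assume "?x u = ?x v"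
    then have "Poly_Mapping.lookup (?x u) u = Poly_Mapping.lookup (?x v) u" by simp
    then show "u = v" by (auto simp: lookup_single when_def split: if_splits)
  qed
  have "0 \<noteq> ?x v" for v
    by (metis lookup_single_eq lookup_zero zero_neq_one)
  then have notin: "0 \<notin> range ?x" by blast
  have "Poly_Mapping.keys p \<subseteq> insert 0 (range ?x)"
    using assms monomial_degree_le_1 by (fastforce simp: affine_poly_def)
  then have "p = (\<Sum>m\<in>insert 0 (range ?x). Poly_Mapping.single m (Poly_Mapping.lookup p m))"
    by (intro poly_mapping_sum_singles) auto
  also have "\<dots> = Poly_Mapping.single 0 (Poly_Mapping.lookup p 0) +
      (\<Sum>v\<in>UNIV. Poly_Mapping.single (?x v) (Poly_Mapping.lookup p (?x v)))"
    using notin by (simp add: sum.reindex[OF inj] o_def del: One_nat_def)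
  finally show ?thesis
    by (simp add: Const_def Var_def mult_single)
qed

lemma lookup_Const_mult: "Poly_Mapping.lookup (Const c * p) m = c * Poly_Mapping.lookup p m"
proof -
  have "Const c * p = Poly_Mapping.map ((*) c) p"
    by (simp add: Const_def mult_map_scale_conv_mult)
  then show ?thesis
    by (simp add: map.rep_eq when_def)
qed

lemma affine_poly_Const [simp]: "affine_poly (Const c)"
  by (simp add: affine_poly_def Const_def)

lemma affine_poly_Var [simp]: "affine_poly (Var v)"
proof -
  have "(\<Sum>u\<in>UNIV. Poly_Mapping.lookup (Poly_Mapping.single v (1::nat)) u) =
      (\<Sum>u\<in>UNIV. if u = v then 1 else 0)"
    by (rule sum.cong) (auto simp: lookup_single when_def)
  then show ?thesis by (simp add: affine_poly_def Var_def)
qed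

lemma affine_poly_add: "affine_poly p \<Longrightarrow> affine_poly q \<Longrightarrow> affine_poly (p + q)"
  using keys_add[of p q] by (auto simp: affine_poly_def)

lemma affine_poly_Const_mult: "affine_poly p \<Longrightarrow> affine_poly (Const c * p)"
  by (auto simp: affine_poly_def in_keys_iff lookup_Const_mult)

lemma affine_poly_diff: "affine_poly p \<Longrightarrow> affine_poly q \<Longrightarrow> affine_poly (p - q)"
  using affine_poly_add[of p "Const (- 1) * q"] affine_poly_Const_mult[of q "- 1"]
  by (simp add: Const_uminus)

lemma affine_poly_sum: "(\<And>i. i \<in> A \<Longrightarrow> affine_poly (f i)) \<Longrightarrow> affine_poly (\<Sum>i\<in>A. f i)"
proof (induction A rule: infinite_finite_induct)
  case (insert x A)
  then show ?case by (simp add: affine_poly_add)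
qed (simp_all add: affine_poly_def)

section \<open>Affine changes of coordinates\<close>

lemma mpoly_subst_affine:
  fixes \<sigma> :: "'v::finite \<Rightarrow> ('w, 'k::field) mpoly"
  assumes "affine_poly p"
  shows "mpoly_subst \<sigma> p = Const (Poly_Mapping.lookup p 0) +
    (\<Sum>v\<in>UNIV. Const (Poly_Mapping.lookup p (Poly_Mapping.single v 1)) * \<sigma> v)"
proof -
  interpret ring_map "mpoly_subst \<sigma>" by (rule ring_map_mpoly_subst)
  show ?thesis
    by (subst affine_poly_expansion[OF assms]) (simp only: add mult sum mpoly_subst_Const mpoly_subst_Var)
qed

lemma affine_poly_mpoly_subst:
  "affine_poly p \<Longrightarrow> (\<And>v. affine_poly (\<sigma> v)) \<Longrightarrow> affine_poly (mpoly_subst \<sigma> p)"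
  by (simp add: mpoly_subst_affine affine_poly_add affine_poly_sum affine_poly_Const_mult)

lemma mpoly_subst_affine_fixed:
  assumes p: "affine_poly p" and "Poly_Mapping.lookup p (Poly_Mapping.single w 1) = 0"
    and "\<And>v. v \<noteq> w \<Longrightarrow> \<sigma> v = Var v"
  shows "mpoly_subst \<sigma> p = p"
proof -
  have "(\<Sum>v\<in>UNIV. Const (Poly_Mapping.lookup p (Poly_Mapping.single v 1)) * \<sigma> v) =
      (\<Sum>v\<in>UNIV. Const (Poly_Mapping.lookup p (Poly_Mapping.single v 1)) * Var v)"
    by (rule sum.cong) (use assms in \<open>metis Const_0 mult_zero_left\<close>)+
  then show ?thesis
    using affine_poly_expansion[OF p] by (simp add: mpoly_subst_affine[OF p])
qed

lemma lookup_Var: "Poly_Mapping.lookup (Var v) (Poly_Mapping.single u 1) = (if u = v then 1 else 0)"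
proof -
  have "Poly_Mapping.single v (1::nat) = Poly_Mapping.single u 1 \<longleftrightarrow> u = v"
    by (metis lookup_single_eq lookup_single_not_eq zero_neq_one)
  then show ?thesis by (simp add: Var_def lookup_single when_def)
qed

text \<open>Write \<open>z = Const c * Var w + r\<close> with \<open>r\<close> free of
  \<open>Var w\<close>. Then \<open>\<tau>\<close> sends \<open>Var w\<close> to \<open>z\<close>,
  and its inverse \<open>\<theta>\<close> sends \<open>Var w\<close> to
  \<open>Const (1 / c) * (Var w - r)\<close>; the other variables stay fixed.\<close>

lemma ex_elementary_automorphism:
  fixes z :: "('v::finite, 'k::field) mpoly"
  assumes z: "affine_poly z" and c: "Poly_Mapping.lookup z (Poly_Mapping.single w 1) \<noteq> 0"
  obtains \<theta> \<tau> :: "'v \<Rightarrow> ('v, 'k) mpoly" where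
    "\<And>v. affine_poly (\<theta> v)" "mpoly_subst \<theta> z = Var w" "\<And>v. v \<noteq> w \<Longrightarrow> \<theta> v = Var v"
    "\<And>p. mpoly_subst \<theta> (mpoly_subst \<tau> p) = p" "\<And>p. mpoly_subst \<tau> (mpoly_subst \<theta> p) = p"
proof -
  define c where "c = Poly_Mapping.lookup z (Poly_Mapping.single w 1)"
  define r where "r = z - Const c * Var w"
  define \<theta> where "\<theta> = Var (w := Const (1 / c) * (Var w - r))"
  define \<tau> where "\<tau> = Var (w := z)"
  have c0: "c \<noteq> 0" using c by (simp add: c_def)
  have r: "affine_poly r" "Poly_Mapping.lookup r (Poly_Mapping.single w 1) = 0"
    by (simp_all add: r_def c_def z affine_poly_diff affine_poly_Const_mult lookup_minus
        lookup_Const_mult lookup_Var del: One_nat_def)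
  have z_eq: "z = Const c * Var w + r" by (simp add: r_def)
  \<comment> \<open>Both substitutions move only \<open>Var w\<close>, which does not occur in
    \<open>r\<close>.\<close>
  have \<theta>r: "mpoly_subst \<theta> r = r" and \<tau>r: "mpoly_subst \<tau> r = r"
    by (rule mpoly_subst_affine_fixed[OF r]; simp add: \<theta>_def \<tau>_def)+
  interpret T: ring_map "mpoly_subst \<theta>" by (rule ring_map_mpoly_subst)
  interpret U: ring_map "mpoly_subst \<tau>" by (rule ring_map_mpoly_subst)
  have inv: "Const c * (Const (1 / c) * q) = q" "Const (1 / c) * (Const c * q) = q"
    for q :: "('v, 'k) mpoly"
    using c0 by (simp_all flip: mult.assoc Const_mult)
  have \<theta>z: "mpoly_subst \<theta> z = Var w"
    by (simp add: z_eq T.add T.mult \<theta>r) (simp add: \<theta>_def inv)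
  have minus: "mpoly_subst \<tau> (p - q) = mpoly_subst \<tau> p - mpoly_subst \<tau> q" for p q
    using U.add[of "p - q" q] by (simp add: algebra_simps)
  have \<tau>\<theta>: "mpoly_subst \<tau> (\<theta> v) = Var v" for v
  proof (cases "v = w")
    case True
    then have "mpoly_subst \<tau> (\<theta> v) = Const (1 / c) * (z - r)"
      by (simp add: \<theta>_def U.mult minus \<tau>r) (simp add: \<tau>_def)
    then show ?thesis by (simp add: z_eq inv True)
  qed (simp add: \<theta>_def \<tau>_def)
  have \<theta>\<tau>: "mpoly_subst \<theta> (\<tau> v) = Var v" for v
    using \<theta>z by (simp add: \<tau>_def) (simp add: \<theta>_def)
  show thesis
  proof (rule that[of \<theta> \<tau>])
    show "affine_poly (\<theta> v)" for v
      by (simp add: \<theta>_def affine_poly_Const_mult affine_poly_diff r)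
    show "\<theta> v = Var v" if "v \<noteq> w" for v using that by (simp add: \<theta>_def)
  qed (simp_all add: \<theta>z mpoly_subst_inverse \<theta>\<tau> \<tau>\<theta>)
qed

text \<open>Gaussian elimination, one form at a time. The condition on 1 says that the affine
  equations are consistent, so every form outside the current span still has a variable to
  eliminate. The inverse is kept in order to transport ideals both ways, and affineness in order to
  bound degrees later.\<close>

lemma ex_straightening:
  fixes W :: "('v::finite, 'k::field) mpoly set"
  assumes "finite W" "\<forall>w\<in>W. affine_poly w" "1 \<notin> mscale.span W"
  shows "\<exists>\<psi> \<psi>' A. algebra_map \<psi> \<and> algebra_map \<psi>' \<and> (\<forall>p. \<psi> (\<psi>' p) = p) \<and>
    (\<forall>p. \<psi>' (\<psi> p) = p) \<and> (\<forall>p. affine_poly p \<longrightarrow> affine_poly (\<psi> p)) \<and>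
    mscale.span (\<psi> ` W) = mscale.span (Var ` A :: ('v, 'k) mpoly set)"
  using assms
proof (induction W rule: finite_induct)
  case empty
  have "algebra_map (\<lambda>p :: ('v, 'k) mpoly. p)"
    by (simp add: algebra_map_def algebra_map_axioms_def ring_map_def)
  then show ?case
    by (intro exI[of _ "\<lambda>p. p"] exI[of _ "{}"]) simp
next
  case (insert z W)
  have "1 \<notin> mscale.span W"
    using insert.prems(2) mscale.span_mono[of W "insert z W"] by blast
  with insert obtain \<psi> \<psi>' :: "('v, 'k) mpoly \<Rightarrow> ('v, 'k) mpoly" and A
    where hom: "algebra_map \<psi>" "algebra_map \<psi>'" and inv: "\<And>p. \<psi> (\<psi>' p) = p" "\<And>p. \<psi>' (\<psi> p) = p"
      and aff: "\<And>p. affine_poly p \<Longrightarrow> affine_poly (\<psi> p)"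
      and W: "mscale.span (\<psi> ` W) = mscale.span (Var ` A)"
    by auto
  \<comment> \<open>The part of \<open>\<psi> z\<close> in the variables of \<open>A\<close>, which
    already lie in the span; \<open>y\<close> is the reduced remainder.\<close>
  define s where "s = (\<Sum>a\<in>A. Const (Poly_Mapping.lookup (\<psi> z) (Poly_Mapping.single a 1)) * Var a)"
  define y where "y = \<psi> z - s"
  have y_aff: "affine_poly y"
    using insert.prems(1)
    by (simp add: y_def s_def aff affine_poly_diff affine_poly_sum affine_poly_Const_mult)
  have y_A: "Poly_Mapping.lookup y (Poly_Mapping.single a 1) = 0" if "a \<in> A" for a
  proof -
    have "(\<Sum>x\<in>A. Poly_Mapping.lookup (\<psi> z) (Poly_Mapping.single x 1) * (if a = x then 1 else 0)) =
        Poly_Mapping.lookup (\<psi> z) (Poly_Mapping.single a 1)"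
      using that by (simp add: if_distrib cong: if_cong)
    then show ?thesis
      by (simp add: y_def s_def lookup_minus lookup_sum lookup_Const_mult lookup_Var del: One_nat_def)
  qed
  have "s \<in> mscale.span (Var ` A)"
    unfolding s_def mscale_def[symmetric]
    by (intro mscale.span_sum mscale.span_scale mscale.span_base) simp
  then have s: "s \<in> mscale.span (insert u (Var ` A))" for u
    using mscale.span_mono[of "Var ` A" "insert u (Var ` A)"] by blast
  have gen: "mscale.span (\<psi> ` insert z W) = mscale.span (insert y (Var ` A))"
  proof -
    have "y \<in> mscale.span (insert (\<psi> z) (Var ` A))"
      unfolding y_def by (intro mscale.span_diff s mscale.span_base) simp
    moreover have "y + s \<in> mscale.span (insert y (Var ` A))"
      by (intro mscale.span_add s mscale.span_base) simp
    ultimately have "mscale.span (insert (\<psi> z) (Var ` A)) = mscale.span (insert y (Var ` A))"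
      by (auto simp: mscale.span_eq mscale.span_base y_def)
    then show ?thesis
      using W by (simp add: mscale.span_insert)
  qed
  show ?case
  proof (cases "\<exists>w. Poly_Mapping.lookup y (Poly_Mapping.single w 1) \<noteq> 0")
    case True
    then obtain w where w: "Poly_Mapping.lookup y (Poly_Mapping.single w 1) \<noteq> 0" by blast
    obtain \<theta> \<tau> where \<theta>: "\<And>v. affine_poly (\<theta> v)" "mpoly_subst \<theta> y = Var w"
        "\<And>v. v \<noteq> w \<Longrightarrow> \<theta> v = Var v"
      and inv': "\<And>p. mpoly_subst \<theta> (mpoly_subst \<tau> p) = p" "\<And>p. mpoly_subst \<tau> (mpoly_subst \<theta> p) = p"
      using ex_elementary_automorphism[OF y_aff w] by metis
    \<comment> \<open>The pivot \<open>w\<close> is not in \<open>A\<close>, as \<open>y\<close> has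
      zero coefficients there, so the variables already obtained are fixed.\<close>
    have "mpoly_subst \<theta> ` insert y (Var ` A) = Var ` insert w A"
    proof -
      have "mpoly_subst \<theta> (Var a) = Var a" if "a \<in> A" for a
        using that w y_A \<theta>(3) by (metis mpoly_subst_Var)
      then show ?thesis by (auto simp: \<theta>(2) image_iff)
    qed
    then have "mscale.span ((\<lambda>p. mpoly_subst \<theta> (\<psi> p)) ` insert z W) = mscale.span (Var ` insert w A)"
      using algebra_map.span_image_cong[OF algebra_map_mpoly_subst gen, of \<theta>] by (simp add: image_image)
    then show ?thesis
      using hom inv inv' \<theta>(1) aff
      by (intro exI[of _ "\<lambda>p. mpoly_subst \<theta> (\<psi> p)"] exI[of _ "\<lambda>p. \<psi>' (mpoly_subst \<tau> p)"]
          exI[of _ "insert w A"])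
        (simp add: algebra_map_compose algebra_map_mpoly_subst affine_poly_mpoly_subst)
  next
    case False
    then have y: "y = Const (Poly_Mapping.lookup y 0)"
      using affine_poly_expansion[OF y_aff] by simp
    \<comment> \<open>A nonzero constant remainder would put 1 into the span of the images, and
      \<open>\<psi>'\<close> would carry it back to the span of the original forms.\<close>
    have "y = 0"
    proof (rule ccontr)
      assume "y \<noteq> 0"
      define c where "c = Poly_Mapping.lookup y 0"
      have "c \<noteq> 0" using y \<open>y \<noteq> 0\<close> by (auto simp: c_def)
      moreover have "y = Const c" using y by (simp add: c_def)
      ultimately have "mscale (1 / c) y = 1"
        by (simp add: mscale_def flip: Const_mult)
      then have "1 \<in> mscale.span (\<psi> ` insert z W)"
        unfolding gen by (metis mscale.span_scale mscale.span_base insertI1)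
      then have "\<psi>' 1 \<in> mscale.span (\<psi>' ` \<psi> ` insert z W)"
        by (rule algebra_map.in_span_image[OF hom(2)])
      moreover have "\<psi>' 1 = 1"
        using algebra_map.Const[OF hom(2), of 1] by simp
      ultimately show False
        using insert.prems(2) by (simp add: image_image inv)
    qed
    then have "mscale.span (\<psi> ` insert z W) = mscale.span (Var ` A)"
      unfolding gen by simp
    then show ?thesis using hom inv aff by blast
  qed
qed

text \<open>In straightened coordinates the generators are variables, so membership in a power
  becomes a bound on the order. The ideal itself is listed separately because its first power is by
  definition a product with the whole ring.\<close>

lemma ex_order_automorphism:
  fixes W :: "('v::finite, 'k::field) mpoly set"
  assumes "finite W" "\<forall>w\<in>W. affine_poly w" "1 \<notin> mscale.span W"
  obtains \<psi> :: "('v, 'k) mpoly \<Rightarrow> ('v, 'k) mpoly" and A where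
    "ring_map \<psi>" "inj \<psi>" "\<And>p. affine_poly p \<Longrightarrow> affine_poly (\<psi> p)"
    "\<And>p k. p \<in> ideal_power (ideal_gen W) k \<longleftrightarrow> \<psi> p \<in> order_ideal A k"
    "\<And>p. p \<in> ideal_gen W \<longleftrightarrow> \<psi> p \<in> order_ideal A 1"
proof -
  obtain \<psi> \<psi>' :: "('v, 'k) mpoly \<Rightarrow> ('v, 'k) mpoly" and A
    where alg: "algebra_map \<psi>" "algebra_map \<psi>'"
      and inv: "\<And>p. \<psi> (\<psi>' p) = p" "\<And>p. \<psi>' (\<psi> p) = p"
      and aff: "\<And>p. affine_poly p \<Longrightarrow> affine_poly (\<psi> p)"
      and span: "mscale.span (\<psi> ` W) = mscale.span (Var ` A)"
    using ex_straightening[OF assms] by blast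
  note hom = alg[THEN algebra_map.axioms(1)]
  have W: "ideal_gen (\<psi> ` W) = ideal_gen (Var ` A)"
    using span by (rule ideal_gen_mscale_span_cong)
  have I: "\<psi> p \<in> ideal_gen (Var ` A)" if "p \<in> ideal_gen W" for p
    using ring_map.in_ideal_gen_image[OF hom(1) that] by (simp add: W)
  have I': "\<psi>' p \<in> ideal_gen W" if "p \<in> ideal_gen (Var ` A)" for p
    using ring_map.in_ideal_gen_image[OF hom(2), of p "\<psi> ` W"] that by (simp add: W inv image_image)
  have power: "p \<in> ideal_power (ideal_gen W) k \<longleftrightarrow> \<psi> p \<in> order_ideal A k" for p k
    unfolding power_Var_ideal[symmetric]
    using ring_map.in_ideal_power_image[OF hom(1) I, where x = p and k = k]
      ring_map.in_ideal_power_image[OF hom(2) I', where x = "\<psi> p" and k = k] by (auto simp: inv)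
  have "p \<in> ideal_gen W \<longleftrightarrow> \<psi> p \<in> order_ideal A 1" for p
  proof -
    have "p * 1 \<in> ideal_power (ideal_gen W) (Suc 0)" if "p \<in> ideal_gen W"
      using that by (rule ideal_power_SucI) simp
    moreover have "ideal_power (ideal_gen W) (Suc 0) \<subseteq> ideal_gen W"
      by (rule ideal_power_Suc_minimal) (auto intro: ideal_mult_right)
    ultimately show ?thesis by (auto simp flip: power simp del: ideal_power.simps)
  qed
  moreover have "inj \<psi>"
    by (rule inj_on_inverseI[of _ \<psi>']) (rule inv)
  ultimately show thesis
    using that hom(1) aff power by blast
qed

section \<open>Properness, primary powers and colons\<close>

lemma one_notin_ideal_gen_affine:
  fixes W :: "('v::finite, 'k::field) mpoly set"
  assumes "finite W" "\<forall>w\<in>W. affine_poly w" "1 \<notin> mscale.span W"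
  shows "1 \<notin> ideal_gen W"
proof -
  obtain \<psi> :: "('v, 'k) mpoly \<Rightarrow> ('v, 'k) mpoly" and A where
    "ring_map \<psi>" "\<And>p. p \<in> ideal_gen W \<longleftrightarrow> \<psi> p \<in> order_ideal A 1"
    using ex_order_automorphism[OF assms] by metis
  \<comment> \<open>The monomial of 1 has degree zero in the variables of \<open>A\<close>.\<close>
  then show ?thesis
    by (simp add: ring_map.one order_ideal_def)
qed

text \<open>An element outside the ideal has order zero, and orders add, so multiplication by
  \<open>b\<close> cannot raise the order of \<open>a\<close>.\<close>

lemma ideal_power_primary:
  fixes W :: "('v::finite, 'k::field) mpoly set"
  assumes W: "finite W" "\<forall>w\<in>W. affine_poly w" "1 \<notin> mscale.span W"
    and "a * b \<in> ideal_power (ideal_gen W) k" "b \<notin> ideal_gen W"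
  shows "a \<in> ideal_power (ideal_gen W) k"
proof (cases k)
  case (Suc i)
  obtain \<psi> :: "('v, 'k) mpoly \<Rightarrow> ('v, 'k) mpoly" and A where \<psi>:
    "ring_map \<psi>" "\<And>p k. p \<in> ideal_power (ideal_gen W) k \<longleftrightarrow> \<psi> p \<in> order_ideal A k"
    "\<And>p. p \<in> ideal_gen W \<longleftrightarrow> \<psi> p \<in> order_ideal A 1"
    using ex_order_automorphism[OF W] by metis
  show ?thesis
    using order_ideal_mult_notin[of "\<psi> a" A i "\<psi> b" 0] assms(4,5) Suc
    by (auto simp: \<psi> ring_map.mult[OF \<psi>(1)] simp del: ideal_power.simps)
qed simp

text \<open>The coordinate change keeps \<open>x\<close> affine and nonzero, so its order is at most
  one and dividing by it costs at most one power.\<close>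

lemma ideal_power_colon_affine:
  fixes W :: "('v::finite, 'k::field) mpoly set"
  assumes W: "finite W" "\<forall>w\<in>W. affine_poly w" "1 \<notin> mscale.span W"
    and x: "affine_poly x" "x \<noteq> 0"
    and xh: "x * h \<in> ideal_power (ideal_gen W) (Suc k)"
  shows "h \<in> ideal_power (ideal_gen W) k"
proof (cases k)
  case (Suc i)
  obtain \<psi> :: "('v, 'k) mpoly \<Rightarrow> ('v, 'k) mpoly" and A where \<psi>:
    "ring_map \<psi>" "inj \<psi>" "\<And>p. affine_poly p \<Longrightarrow> affine_poly (\<psi> p)"
    "\<And>p k. p \<in> ideal_power (ideal_gen W) k \<longleftrightarrow> \<psi> p \<in> order_ideal A k"
    using ex_order_automorphism[OF W] by metis
  have "\<psi> x \<noteq> 0"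
    using x(2) \<psi>(2) ring_map.zero[OF \<psi>(1)] by (metis injD)
  then obtain m where m: "m \<in> Poly_Mapping.keys (\<psi> x)"
    by (metis ex_in_conv keys_eq_empty)
  have "(\<Sum>v\<in>A. Poly_Mapping.lookup m v) \<le> (\<Sum>v\<in>UNIV. Poly_Mapping.lookup m v)"
    by (rule sum_mono2) auto
  also have "\<dots> \<le> 1" using \<psi>(3)[OF x(1)] m by (simp add: affine_poly_def)
  finally have "\<psi> x \<notin> order_ideal A (Suc 1)"
    using m by (fastforce simp: order_ideal_def)
  then show ?thesis
    using order_ideal_mult_notin[of "\<psi> x" A 1 "\<psi> h" i] xh Suc
    by (auto simp: \<psi> ring_map.mult[OF \<psi>(1)] simp del: ideal_power.simps)
qed simp

text \<open>If \<open>W\<close> generates the unit ideal there is nothing to show. If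
  \<open>x\<close> lies in the ideal, then \<open>insert x W\<close> generates the same ideal, and
  dividing by \<open>x\<close> loses the one extra power. Otherwise \<open>x\<close> has order zero
  and the first membership is enough.\<close>

lemma ideal_power_colon:
  fixes W :: "('v::finite, 'k::field) mpoly set"
  assumes W: "finite W" "\<forall>w\<in>W. affine_poly w" and x: "affine_poly x" "x \<noteq> 0"
    and xh: "x * h \<in> ideal_power (ideal_gen W) k"
    and xh': "x * h \<in> ideal_power (ideal_gen (insert x W)) (Suc k)"
  shows "h \<in> ideal_power (ideal_gen W) k"
proof -
  consider "1 \<in> mscale.span W" | "1 \<notin> mscale.span W" "x \<in> ideal_gen W"
    | "1 \<notin> mscale.span W" "x \<notin> ideal_gen W"
    by blast
  then show ?thesis
  proof cases
    case 1
    then have "ideal_gen W = UNIV"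
      using mscale_span_subset_ideal_gen by (auto simp: ideal_eq_UNIV_iff)
    then show ?thesis by simp
  next
    case 2
    have "ideal_gen (insert x W) = ideal_gen W"
      using 2 by (intro ideal_gen_eqI) (auto simp: ideal_gen_base)
    with xh' 2 show ?thesis using ideal_power_colon_affine[OF W _ x] by simp
  next
    case 3
    with xh show ?thesis
      using ideal_power_primary[OF W, of h x k] by (simp add: mult.commute)
  qed
qed

section \<open>Ideals of fold products\<close>

text \<open>General index sets replace \<open>{1..n}\<close> so that an induction can remove one
  index.\<close>

definition fold_ideal :: "('i \<Rightarrow> 'a::comm_ring_1) \<Rightarrow> 'i set \<Rightarrow> nat \<Rightarrow> 'a set" where
  "fold_ideal l N d = ideal_gen {\<Prod>i\<in>T. l i | T. T \<subseteq> N \<and> card T = d}"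

text \<open>Truncated subtraction gives small \<open>S\<close> the exponent zero, hence no
  condition. For finite \<open>N\<close> and \<open>d > card N\<close> the set \<open>S = {}\<close>
  has a positive exponent and forces zero, in agreement with \<open>fold_ideal\<close>.\<close>

definition subset_powers :: "('i \<Rightarrow> 'a::comm_ring_1) \<Rightarrow> 'i set \<Rightarrow> nat \<Rightarrow> 'a set" where
  "subset_powers l N d = (\<Inter>S\<in>Pow N. ideal_power (ideal_gen (l ` S)) (d + card S - card N))"

lemma subspace_fold_ideal [simp]: "ideal.subspace (fold_ideal l N d)"
  by (simp add: fold_ideal_def)

lemma subspace_subset_powers [simp]: "ideal.subspace (subset_powers l N d)"
  unfolding subset_powers_def by (rule ideal.subspace_Int) simp

lemma subset_powersD:
  "f \<in> subset_powers l N d \<Longrightarrow> S \<subseteq> N \<Longrightarrow> f \<in> ideal_power (ideal_gen (l ` S)) (d + card S - card N)"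
  by (simp add: subset_powers_def)

lemma subset_powersI:
  "(\<And>S. S \<subseteq> N \<Longrightarrow> f \<in> ideal_power (ideal_gen (l ` S)) (d + card S - card N)) \<Longrightarrow>
    f \<in> subset_powers l N d"
  by (simp add: subset_powers_def)

text \<open>A set of \<open>d\<close> indices misses only \<open>card N - d\<close> of them, so at
  least \<open>d + card S - card N\<close> factors come from \<open>S\<close>.\<close>

lemma fold_ideal_subset_powers:
  assumes "finite N"
  shows "fold_ideal l N d \<subseteq> subset_powers l N d"
  unfolding fold_ideal_def
proof (rule ideal_gen_minimal)
  have "(\<Prod>i\<in>T. l i) \<in> subset_powers l N d" if T: "T \<subseteq> N" "card T = d" for T
  proof (rule subset_powersI)
    fix S assume S: "S \<subseteq> N"
    have fin: "finite T" "finite S" using assms T S finite_subset by blast+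
    have "card T + card S = card (T \<union> S) + card (T \<inter> S)" by (rule card_Un_Int[OF fin])
    moreover have "card (T \<union> S) \<le> card N" using assms T S by (intro card_mono) auto
    ultimately have "d + card S - card N \<le> card (T \<inter> S)" using T by linarith
    moreover have "(\<Prod>i\<in>T \<inter> S. l i) \<in> ideal_power (ideal_gen (l ` S)) (card (T \<inter> S))"
      using fin by (intro prod_in_ideal_power) (auto intro: ideal_gen_base)
    ultimately have "(\<Prod>i\<in>T \<inter> S. l i) \<in> ideal_power (ideal_gen (l ` S)) (d + card S - card N)"
      using ideal_power_antimono by blast
    moreover have "(\<Prod>i\<in>T. l i) = (\<Prod>i\<in>T \<inter> S. l i) * (\<Prod>i\<in>T - S. l i)"
      using prod.Int_Diff[OF fin(1)] by blast
    ultimately show "(\<Prod>i\<in>T. l i) \<in> ideal_power (ideal_gen (l ` S)) (d + card S - card N)"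
      by (simp add: ideal_mult_right)
  qed
  then show "{\<Prod>i\<in>T. l i | T. T \<subseteq> N \<and> card T = d} \<subseteq> subset_powers l N d" by blast
qed simp

lemma fold_ideal_mono: "N \<subseteq> M \<Longrightarrow> fold_ideal l N d \<subseteq> fold_ideal l M d"
  unfolding fold_ideal_def by (rule ideal_gen_mono) blast

lemma fold_ideal_0: "fold_ideal l N 0 = UNIV"
proof -
  have "(\<Prod>i\<in>{}. l i) \<in> fold_ideal l N 0"
    unfolding fold_ideal_def by (rule ideal_gen_base) (force simp: exI[of _ "{}"])
  then show ?thesis by (simp add: ideal_eq_UNIV_iff)
qed

text \<open>Adjoining \<open>i\<close> to \<open>T\<close> turns generators into generators; the
  colon ideal extends this to all of \<open>fold_ideal l N k\<close>.\<close>

lemma fold_ideal_insert_mult: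
  assumes "finite N" "i \<notin> N" "g \<in> fold_ideal l N k"
  shows "l i * g \<in> fold_ideal l (insert i N) (Suc k)"
proof -
  have "fold_ideal l N k \<subseteq> {g. l i * g \<in> fold_ideal l (insert i N) (Suc k)}" (is "_ \<subseteq> ?J")
    unfolding fold_ideal_def[of l N k]
  proof (rule ideal_gen_minimal)
    have "l i * (\<Prod>j\<in>T. l j) \<in> fold_ideal l (insert i N) (Suc k)" if T: "T \<subseteq> N" "card T = k" for T
    proof -
      have "finite T" "i \<notin> T" using T assms finite_subset by auto
      then have "l i * (\<Prod>j\<in>T. l j) = (\<Prod>j\<in>insert i T. l j)" "card (insert i T) = Suc k"
        using T by simp_all
      with T show ?thesis
        unfolding fold_ideal_def by (intro ideal_gen_base CollectI exI[of _ "insert i T"]) auto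
    qed
    then show "{\<Prod>i\<in>T. l i | T. T \<subseteq> N \<and> card T = k} \<subseteq> ?J" by blast
    show "ideal.subspace ?J"
      by (rule subspace_colon) simp
  qed
  with assms show ?thesis by blast
qed

text \<open>For \<open>S\<close> inside \<open>N\<close> the exponent is the same on both sides,
  since the degree and the number of forms both drop by one.\<close>

lemma subset_powers_insert_Suc:
  assumes "finite N" "i \<notin> N"
  shows "subset_powers l (insert i N) (Suc k) \<subseteq> subset_powers l N k"
proof
  fix f assume f: "f \<in> subset_powers l (insert i N) (Suc k)"
  show "f \<in> subset_powers l N k"
  proof (rule subset_powersI)
    fix S assume "S \<subseteq> N"
    then show "f \<in> ideal_power (ideal_gen (l ` S)) (k + card S - card N)"
      using subset_powersD[OF f, of S] assms by auto
  qed
qed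

text \<open>Adding the index of a zero form to \<open>S\<close> keeps the ideal, and adding it to
  both \<open>S\<close> and \<open>N\<close> keeps the exponent. So the condition at
  \<open>insert i S\<close> is the one wanted at \<open>S\<close>.\<close>

lemma subset_powers_insert_zero:
  assumes "finite N" "i \<notin> N" "l i = 0"
  shows "subset_powers l (insert i N) d \<subseteq> subset_powers l N d"
proof
  fix f assume f: "f \<in> subset_powers l (insert i N) d"
  show "f \<in> subset_powers l N d"
  proof (rule subset_powersI)
    fix S assume S: "S \<subseteq> N"
    then have "finite S" "i \<notin> S" using assms finite_subset by auto
    moreover have "ideal_gen (l ` insert i S) = ideal_gen (l ` S)"
      by (intro ideal_gen_eqI) (auto simp: assms(3) ideal.subspace_0 intro: ideal_gen_base)
    ultimately show "f \<in> ideal_power (ideal_gen (l ` S)) (d + card S - card N)"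
      using subset_powersD[OF f, of "insert i S"] S assms by auto
  qed
qed

section \<open>Reduction modulo one form\<close>

lemma (in ring_map) subset_powers_image:
  assumes "f \<in> subset_powers l N d"
  shows "\<phi> f \<in> subset_powers (\<lambda>i. \<phi> (l i)) N d"
proof (rule subset_powersI)
  fix S assume S: "S \<subseteq> N"
  have "\<phi> x \<in> ideal_gen ((\<lambda>i. \<phi> (l i)) ` S)" if "x \<in> ideal_gen (l ` S)" for x
    using in_ideal_gen_image[OF that] by (simp add: image_image)
  then show "\<phi> f \<in> ideal_power (ideal_gen ((\<lambda>i. \<phi> (l i)) ` S)) (d + card S - card N)"
    using in_ideal_power_image subset_powersD[OF assms S] by blast
qed

text \<open>Solving \<open>e = 0\<close> for \<open>Var w\<close>: with \<open>c\<close> the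
  coefficient of \<open>Var w\<close> in \<open>e\<close>, subtracting \<open>e / c\<close> from
  \<open>Var w\<close> subtracts exactly \<open>e\<close> from \<open>e\<close> and changes nothing
  modulo \<open>e\<close>.\<close>

lemma ex_killing_subst:
  fixes e :: "('v::finite, 'k::field) mpoly"
  assumes e: "affine_poly e" and c: "Poly_Mapping.lookup e (Poly_Mapping.single w 1) \<noteq> 0"
  obtains \<sigma> :: "'v \<Rightarrow> ('v, 'k) mpoly" where "\<And>v. affine_poly (\<sigma> v)" "mpoly_subst \<sigma> e = 0"
    "\<And>p. e dvd mpoly_subst \<sigma> p - p"
proof -
  define c where "c = Poly_Mapping.lookup e (Poly_Mapping.single w 1)"
  define \<sigma> where "\<sigma> v = Var v - (if v = w then Const (1 / c) * e else 0)" for v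
  have "c \<noteq> 0" using c by (simp add: c_def)
  then have inv: "Const c * (Const (1 / c) * e) = e"
    by (simp flip: mult.assoc Const_mult)
  have "mpoly_subst \<sigma> e = Const (Poly_Mapping.lookup e 0) +
      (\<Sum>v\<in>UNIV. Const (Poly_Mapping.lookup e (Poly_Mapping.single v 1)) * Var v -
        (if v = w then Const c * (Const (1 / c) * e) else 0))"
    unfolding mpoly_subst_affine[OF e]
    by (intro arg_cong2[of _ _ _ _ "(+)"] refl sum.cong) (auto simp: \<sigma>_def c_def right_diff_distrib)
  also have "\<dots> = (Const (Poly_Mapping.lookup e 0) +
      (\<Sum>v\<in>UNIV. Const (Poly_Mapping.lookup e (Poly_Mapping.single v 1)) * Var v)) - e"
    by (simp add: sum_subtractf inv del: One_nat_def)
  also have "\<dots> = 0"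
    using affine_poly_expansion[OF e] by simp
  finally have "mpoly_subst \<sigma> e = 0" .
  moreover have "affine_poly (\<sigma> v)" for v
    using affine_poly_Const[of 0] by (simp add: \<sigma>_def e affine_poly_diff affine_poly_Const_mult)
  moreover have "e dvd mpoly_subst \<sigma> p - p" for p
    by (rule dvd_mpoly_subst_diff) (simp add: \<sigma>_def)
  ultimately show thesis using that by blast
qed

text \<open>Each generator is the image under \<open>\<phi>\<close> of a product of the original
  forms, hence congruent to that product modulo \<open>e\<close>. The elements congruent to a member
  of \<open>fold_ideal l N d\<close> form an ideal.\<close>

lemma fold_ideal_cong_dvd:
  assumes "f \<in> fold_ideal (\<lambda>i. \<phi> (l i)) N d" "ring_map \<phi>" "\<And>p. e dvd \<phi> p - p"
  obtains g where "g \<in> fold_ideal l N d" "e dvd f - g"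
proof -
  interpret ring_map \<phi> by fact
  let ?J = "{f. \<exists>g\<in>fold_ideal l N d. e dvd f - g}"
  have "fold_ideal (\<lambda>i. \<phi> (l i)) N d \<subseteq> ?J"
    unfolding fold_ideal_def[of "\<lambda>i. \<phi> (l i)"]
  proof (rule ideal_gen_minimal)
    show "{\<Prod>i\<in>T. \<phi> (l i) | T. T \<subseteq> N \<and> card T = d} \<subseteq> ?J"
    proof clarify
      fix T assume "T \<subseteq> N" "d = card T"
      then show "\<exists>g\<in>fold_ideal l N (card T). e dvd (\<Prod>i\<in>T. \<phi> (l i)) - g"
        using assms(3)[of "\<Prod>i\<in>T. l i"] unfolding fold_ideal_def prod
        by (intro bexI[of _ "\<Prod>i\<in>T. l i"] ideal_gen_base) auto
    qed
    have "0 \<in> ?J" by (auto intro!: bexI[of _ 0] simp: ideal.subspace_0)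
    moreover have "x + y \<in> ?J" if xy: "x \<in> ?J" "y \<in> ?J" for x y
    proof -
      obtain a b where ab: "a \<in> fold_ideal l N d" "b \<in> fold_ideal l N d" "e dvd x - a" "e dvd y - b"
        using xy by blast
      then have "e dvd (x - a) + (y - b)" by (intro dvd_add)
      moreover have "(x - a) + (y - b) = (x + y) - (a + b)" by simp
      ultimately show ?thesis
        using ideal.subspace_add[OF subspace_fold_ideal ab(1,2)] by auto
    qed
    moreover have "c * x \<in> ?J" if x: "x \<in> ?J" for c x
    proof -
      obtain a where a: "a \<in> fold_ideal l N d" "e dvd x - a"
        using x by blast
      then have "e dvd c * x - c * a" by (simp flip: right_diff_distrib)
      then show ?thesis
        using ideal.subspace_scale[OF subspace_fold_ideal a(1)] by auto
    qed
    ultimately show "ideal.subspace ?J"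
      unfolding ideal.subspace_def by blast
  qed
  with assms(1) that show thesis by blast
qed

text \<open>The conditions at \<open>S\<close> and at \<open>insert i S\<close> are the two
  memberships from which \<open>ideal_power_colon\<close> cancels \<open>l i\<close>.\<close>

lemma subset_powers_colon:
  fixes l :: "'i \<Rightarrow> ('v::finite, 'k::field) mpoly"
  assumes N: "finite N" "i \<notin> N" and aff: "\<forall>j\<in>insert i N. affine_poly (l j)" and "l i \<noteq> 0"
    and h: "l i * h \<in> subset_powers l (insert i N) (Suc k)"
  shows "h \<in> subset_powers l N k"
proof (rule subset_powersI)
  fix S assume S: "S \<subseteq> N"
  then have fin: "finite S" "i \<notin> S" using N finite_subset by auto
  show "h \<in> ideal_power (ideal_gen (l ` S)) (k + card S - card N)"
  \<comment> \<open>Only where the subtraction is not truncated is the exponent at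
    \<open>insert i S\<close> sure to be one larger; exponent zero asks for nothing.\<close>
  proof (cases "k + card S - card N = 0")
    case False
    then have "Suc k + card (insert i S) - card (insert i N) = Suc (k + card S - card N)"
      using N fin by simp
    with subset_powersD[OF h, of "insert i S"] S
    have "l i * h \<in> ideal_power (ideal_gen (insert (l i) (l ` S))) (Suc (k + card S - card N))"
      by (auto simp del: ideal_power.simps)
    moreover have "l i * h \<in> ideal_power (ideal_gen (l ` S)) (k + card S - card N)"
      using subset_powersD[OF h, of S] S N by auto
    moreover have "finite (l ` S)" "\<forall>w\<in>l ` S. affine_poly w" "affine_poly (l i)"
      using aff S fin by auto
    ultimately show ?thesis
      using ideal_power_colon \<open>l i \<noteq> 0\<close> by blast
  qed simp
qed

section \<open>Fold ideals as intersections over all subsets\<close>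

theorem fold_ideal_eq_subset_powers:
  fixes l :: "'i \<Rightarrow> ('v::finite, 'k::field) mpoly"
  assumes "finite N" "\<forall>i\<in>N. affine_poly (l i)"
  shows "fold_ideal l N d = subset_powers l N d"
proof
  show "fold_ideal l N d \<subseteq> subset_powers l N d"
    by (rule fold_ideal_subset_powers) fact
  show "subset_powers l N d \<subseteq> fold_ideal l N d"
    using assms
  \<comment> \<open>The forms vary because a substitution is applied to them, the degree because one
    factor is split off.\<close>
  proof (induction N arbitrary: l d rule: finite_induct)
    case empty
    show ?case
    proof (cases d)
      case (Suc k)
      \<comment> \<open>Only \<open>S = {}\<close> occurs, and positive powers of the zero ideal
        vanish.\<close>
      have "ideal_gen {} = {0 :: ('v, 'k) mpoly}" by (simp add: ideal_gen_def)
      moreover have "ideal_power {0} (Suc k) \<subseteq> {0 :: ('v, 'k) mpoly}"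
        by (rule ideal_power_Suc_minimal) auto
      ultimately have "subset_powers l {} d \<subseteq> {0}"
        by (simp add: subset_powers_def Suc del: ideal_power.simps)
      then show ?thesis
        using ideal.subspace_0[OF subspace_fold_ideal] by blast
    qed (simp add: fold_ideal_0)
  next
    case (insert i N)
    show ?case
    proof (cases d)
      case (Suc k)
      have aff_i: "affine_poly (l i)" using insert.prems by simp
      consider (zero) "l i = 0"
        | (unit) c where "l i = Const c" "c \<noteq> 0"
        | (nonconst) w where "l i \<noteq> 0" "Poly_Mapping.lookup (l i) (Poly_Mapping.single w 1) \<noteq> 0"
      proof (cases "\<exists>w. Poly_Mapping.lookup (l i) (Poly_Mapping.single w 1) \<noteq> 0")
        case True
        then show thesis using nonconst by fastforce
      next
        case False
        then have "l i = Const (Poly_Mapping.lookup (l i) 0)"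
          using affine_poly_expansion[OF aff_i] by simp
        then show thesis using zero unit by (metis Const_0)
      qed
      then show ?thesis
      proof cases
        case zero
        then show ?thesis
          using insert subset_powers_insert_zero[of N i l d] fold_ideal_mono[of N "insert i N" l d]
          by fastforce
      next
        case unit
        show ?thesis
        proof
          fix f assume "f \<in> subset_powers l (insert i N) d"
          then have "f \<in> fold_ideal l N k"
            using insert subset_powers_insert_Suc[of N i l k] by (auto simp: Suc)
          \<comment> \<open>After division by \<open>c\<close>, the unit \<open>l i\<close> supplies
            the missing \<open>d\<close>-th factor.\<close>
          then have "Const (1 / c) * f \<in> fold_ideal l N k"
            by (simp add: ideal.subspace_scale)
          then have "l i * (Const (1 / c) * f) \<in> fold_ideal l (insert i N) d"
            unfolding Suc using insert by (intro fold_ideal_insert_mult) auto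
          moreover have "l i * (Const (1 / c) * f) = f"
            using unit by (simp flip: mult.assoc Const_mult)
          ultimately show "f \<in> fold_ideal l (insert i N) d" by simp
        qed
      next
        case nonconst
        obtain \<sigma> where \<sigma>: "\<And>v. affine_poly (\<sigma> v)" "mpoly_subst \<sigma> (l i) = 0"
          "\<And>p. l i dvd mpoly_subst \<sigma> p - p"
          using ex_killing_subst[OF aff_i nonconst(2)] by metis
        show ?thesis
        proof
          fix f assume f: "f \<in> subset_powers l (insert i N) d"
          have "mpoly_subst \<sigma> f \<in> subset_powers (\<lambda>j. mpoly_subst \<sigma> (l j)) (insert i N) d"
            using ring_map.subset_powers_image[OF ring_map_mpoly_subst f] .
          \<comment> \<open>The form at \<open>i\<close> has become zero and is dropped with the
            degree unchanged.\<close>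
          then have "mpoly_subst \<sigma> f \<in> subset_powers (\<lambda>j. mpoly_subst \<sigma> (l j)) N d"
            using subset_powers_insert_zero[of N i "\<lambda>j. mpoly_subst \<sigma> (l j)" d] insert \<sigma>(2) by auto
          then have "mpoly_subst \<sigma> f \<in> fold_ideal (\<lambda>j. mpoly_subst \<sigma> (l j)) N d"
            using insert.IH[of "\<lambda>j. mpoly_subst \<sigma> (l j)" d] insert.prems \<sigma>(1)
            by (auto simp: affine_poly_mpoly_subst)
          then obtain g where g: "g \<in> fold_ideal l N d" "l i dvd mpoly_subst \<sigma> f - g"
            using fold_ideal_cong_dvd[OF _ ring_map_mpoly_subst \<sigma>(3)] by metis
          \<comment> \<open>Modulo \<open>l i\<close>, both \<open>f\<close> and \<open>g\<close>
            agree with the image of \<open>f\<close>.\<close>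
          have "l i dvd (mpoly_subst \<sigma> f - g) - (mpoly_subst \<sigma> f - f)"
            using g(2) \<sigma>(3) by (rule dvd_diff)
          then obtain h where h: "f - g = l i * h" by auto
          have g': "g \<in> fold_ideal l (insert i N) d"
            using g(1) fold_ideal_mono[of N "insert i N" l d] by blast
          \<comment> \<open>By the easy inclusion \<open>g\<close>, and with it
            \<open>l i * h = f - g\<close>, lies in the intersection, so \<open>l i\<close> can be
            cancelled.\<close>
          then have "g \<in> subset_powers l (insert i N) d"
            using fold_ideal_subset_powers[of "insert i N" l d] insert.hyps(1) by blast
          with f have "l i * h \<in> subset_powers l (insert i N) d"
            unfolding h[symmetric] by (simp add: ideal.subspace_diff)
          then have "h \<in> subset_powers l N k"
            using subset_powers_colon insert nonconst(1) by (metis Suc)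
          then have "h \<in> fold_ideal l N k"
            using insert by auto
          then have "l i * h \<in> fold_ideal l (insert i N) d"
            unfolding Suc using insert by (intro fold_ideal_insert_mult) auto
          then have "g + l i * h \<in> fold_ideal l (insert i N) d"
            using g' by (simp add: ideal.subspace_add)
          then show "f \<in> fold_ideal l (insert i N) d" by (simp flip: h)
        qed
      qed
    qed (simp add: fold_ideal_0)
  qed
qed

section \<open>Flats and homogenization\<close>

text \<open>A finite independent \<open>C\<close> spanning the same space stays independent when
  \<open>x\<close> is added, so the dimensions are compared as cardinalities, although the whole
  polynomial space may be infinite-dimensional.\<close>

lemma dim_insert_gt:
  fixes B :: "('v, 'k::field) mpoly set"
  assumes "finite B" "x \<notin> mscale.span B"
  shows "mscale.dim (mscale.span B) < mscale.dim (mscale.span (insert x B))"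
proof -
  obtain C where C: "C \<subseteq> B" "mscale.independent C" "B \<subseteq> mscale.span C"
    using mscale.maximal_independent_subset by blast
  have span: "mscale.span C = mscale.span B"
    using C mscale.span_mono by (metis mscale.span_eq mscale.span_superset order_trans)
  then have "mscale.span (insert x C) = mscale.span (insert x B)"
    by (simp add: mscale.span_insert)
  moreover have "mscale.independent (insert x C)"
    using C assms(2) span by (intro mscale.independent_insertI) auto
  moreover have "finite C" "x \<notin> C"
    using C assms finite_subset mscale.span_base by blast+
  ultimately show ?thesis
    using mscale.dim_span_eq_card_independent[of C] mscale.dim_span_eq_card_independent[of "insert x C"]
      C span by simp
qed

section \<open>Homogenization as a linear map and its inverse\<close>

lemma homogenization_add: "homogenization (p + q) = homogenization p + homogenization q"
  by (simp add: homogenization_def lookup_add Const_add distrib_right sum.distrib)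

lemma homogenization_mscale: "homogenization (mscale c p) = mscale c (homogenization p)"
  by (simp add: homogenization_def mscale_def lookup_Const_mult Const_mult distrib_left
      sum_distrib_left mult.assoc)

lemma homogenization_zero: "homogenization 0 = 0"
  by (simp add: homogenization_def)

text \<open>This links inconsistency of affine forms, 1 in their span, with the hyperplane at
  infinity in the span of their homogenizations.\<close>

lemma homogenization_one: "homogenization (1 :: ('v::finite, 'k::field) mpoly) = Var None"
proof -
  have "Poly_Mapping.lookup (1 :: ('v, 'k) mpoly) (Poly_Mapping.single v 1) = 0" for v
    by (simp add: lookup_one when_def) (metis lookup_single_eq lookup_zero n_not_Suc_n)
  then show ?thesis
    by (simp add: homogenization_def)
qed

lemma homogenization_in_span:
  "x \<in> mscale.span A \<Longrightarrow> homogenization x \<in> mscale.span (homogenization ` A)"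
proof (induction rule: mscale.span_induct_alt)
  case (step c x y)
  then show ?case
    by (simp add: homogenization_add homogenization_mscale mscale.span_add mscale.span_scale
        mscale.span_base)
qed (simp add: homogenization_zero mscale.span_zero)

text \<open>The new variable is set to 1, which undoes homogenization on affine polynomials and
  sends the hyperplane at infinity to a unit.\<close>

definition dehomogenization :: "('v::finite option, 'k::field) mpoly \<Rightarrow> ('v, 'k) mpoly" where
  "dehomogenization = mpoly_subst (case_option 1 Var)"

lemma algebra_map_dehomogenization: "algebra_map dehomogenization"
  unfolding dehomogenization_def by (rule algebra_map_mpoly_subst)

lemma dehomogenization_Var [simp]:
  "dehomogenization (Var None) = 1" "dehomogenization (Var (Some v)) = Var v"
  by (simp_all add: dehomogenization_def)

lemma dehomogenization_homogenization:
  assumes "affine_poly p"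
  shows "dehomogenization (homogenization p) = p"
proof -
  interpret algebra_map dehomogenization by (rule algebra_map_dehomogenization)
  show ?thesis
    using affine_poly_expansion[OF assms] by (simp add: homogenization_def add sum mult Const)
qed

section \<open>Primary components and the passage from all subsets to flats\<close>

theorem theorem2p7:
  fixes l :: "nat \<Rightarrow> ('v::finite, 'k::field) mpoly" and d n :: nat
  assumes "1 \<le> d" and "d \<le> n"
    and "\<forall>i\<in>{1..n}. linear_poly (l i)"
    and "fold_product_ideal l n d \<noteq> {0}"
  shows "(\<forall>S\<in>decomposition_flats l n d.
            primary_ideal (ideal_power (ideal_gen (l ` S)) (d + card S - n))) \<and>
         fold_product_ideal l n d =
           (\<Inter>S\<in>decomposition_flats l n d. ideal_power (ideal_gen (l ` S)) (d + card S - n))"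
proof -
  let ?h = "\<lambda>i. homogenization (l i)"
  interpret dehom: algebra_map "dehomogenization :: ('v option, 'k) mpoly \<Rightarrow> _"
    by (rule algebra_map_dehomogenization)
  have aff: "affine_poly (l i)" if "i \<in> {1..n}" for i
    using assms(3) that by (simp add: linear_poly_imp_affine_poly)
  have dehom_image: "dehomogenization ` ?h ` S = l ` S" if "S \<subseteq> {1..n}" for S
    unfolding image_image using that by (intro image_cong refl dehomogenization_homogenization aff) auto
  have primary: "primary_ideal (ideal_power (ideal_gen (l ` S)) (d + card S - n))"
    if "S \<in> decomposition_flats l n d" for S
  proof -
    have S: "S \<subseteq> {1..n}" "Var None \<notin> ideal_gen (?h ` S)" "card S \<ge> n - d + 1"
      using that by (auto simp: decomposition_flats_def is_flat_def)
    have fin: "finite (l ` S)" "\<forall>w\<in>l ` S. affine_poly w"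
      using S(1) finite_subset aff by auto
    have one: "1 \<notin> mscale.span (l ` S)"
    proof
      assume "1 \<in> mscale.span (l ` S)"
      then have "Var None \<in> mscale.span (?h ` S)"
        using homogenization_in_span[of 1 "l ` S"] by (simp add: homogenization_one image_image)
      with S(2) show False using mscale_span_subset_ideal_gen by blast
    qed
    \<comment> \<open>The bound on \<open>card S\<close> makes the exponent positive, so the power
      stays inside the proper ideal.\<close>
    obtain k where k: "d + card S - n = Suc k"
      using S(3) assms(2) by (cases "d + card S - n") auto
    let ?I = "ideal_gen (l ` S)"
    have "ideal_power ?I (Suc k) \<subseteq> ?I"
      by (rule ideal_power_Suc_minimal) (auto intro: ideal_mult_right)
    then have "ideal_power ?I (Suc k) \<noteq> UNIV"
      using one_notin_ideal_gen_affine[OF fin one] by blast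
    moreover have "a \<in> ideal_power ?I (Suc k) \<or> (\<exists>j\<ge>1. b ^ j \<in> ideal_power ?I (Suc k))"
      if "a * b \<in> ideal_power ?I (Suc k)" for a b
    proof (cases "b \<in> ?I")
      case True
      then have "b ^ Suc k \<in> ideal_power ?I (Suc k)" by (rule power_in_ideal_power)
      then show ?thesis by (intro disjI2 exI[of _ "Suc k"]) simp
    next
      case False
      then show ?thesis using ideal_power_primary[OF fin one that] by blast
    qed
    ultimately show ?thesis
      unfolding primary_ideal_def k using subspace_ideal_power by blast
  qed
  have "fold_product_ideal l n d = fold_ideal l {1..n} d"
    by (simp add: fold_product_ideal_def fold_ideal_def)
  also have "\<dots> = subset_powers l {1..n} d"
    by (rule fold_ideal_eq_subset_powers) (use aff in auto)
  also have "\<dots> = (\<Inter>S\<in>decomposition_flats l n d. ideal_power (ideal_gen (l ` S)) (d + card S - n))"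
    (is "_ = ?R")
  proof
    show "subset_powers l {1..n} d \<subseteq> ?R"
      by (auto simp: decomposition_flats_def is_flat_def dest: subset_powersD)
    show "?R \<subseteq> subset_powers l {1..n} d"
    proof
      fix f assume f: "f \<in> ?R"
      show "f \<in> subset_powers l {1..n} d"
      proof (rule subset_powersI)
        fix S assume S: "S \<subseteq> {1..n}"
        \<comment> \<open>The closure of \<open>S\<close>: the largest index set with the same span
          of homogenized forms, hence a flat.\<close>
        define F where "F = {i \<in> {1..n}. ?h i \<in> mscale.span (?h ` S)}"
        have F: "S \<subseteq> F" "F \<subseteq> {1..n}" "finite F"
          using S by (auto simp: F_def mscale.span_base)
        then have card: "card S \<le> card F" by (intro card_mono)
        have span: "mscale.span (?h ` F) = mscale.span (?h ` S)"
          using F(1) by (auto simp: mscale.span_eq mscale.span_base F_def)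
        have "mscale.span (dehomogenization ` ?h ` F) = mscale.span (dehomogenization ` ?h ` S)"
          using span by (rule dehom.span_image_cong)
        then have gen: "ideal_gen (l ` F) = ideal_gen (l ` S)"
          unfolding dehom_image[OF S] dehom_image[OF F(2)] by (rule ideal_gen_mscale_span_cong)
        have flat: "is_flat ?h n F"
          unfolding is_flat_def arr_rank_def
          using F dim_insert_gt[of "?h ` F"] by (auto simp: span) (auto simp: F_def)
        \<comment> \<open>Exponent zero imposes nothing; a closure reaching infinity generates the
          unit ideal after dehomogenization; any other closure is in the index set, with the same
          ideal and an exponent at least as large.\<close>
        consider "d + card S - n = 0" | "Var None \<in> ideal_gen (?h ` F)"
          | "d + card S - n \<noteq> 0" "Var None \<notin> ideal_gen (?h ` F)" by blast
        then have "f \<in> ideal_power (ideal_gen (l ` S)) (d + card S - n)"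
        proof cases
          case 2
          then have "dehomogenization (Var None) \<in> ideal_gen (dehomogenization ` ?h ` F)"
            by (rule dehom.in_ideal_gen_image)
          then have "1 \<in> ideal_gen (l ` S)"
            unfolding dehom_image[OF F(2)] gen by simp
          then have "ideal_gen (l ` S) = UNIV" by (simp add: ideal_eq_UNIV_iff)
          then show ?thesis by simp
        next
          case 3
          have "n - d + 1 \<le> card F"
            using 3(1) card assms(2) by linarith
          then have "F \<in> decomposition_flats l n d"
            using flat 3(2) by (simp add: decomposition_flats_def)
          with f have "f \<in> ideal_power (ideal_gen (l ` F)) (d + card F - n)" by blast
          then show ?thesis
            using ideal_power_antimono[of "d + card S - n" "d + card F - n"] card
            unfolding gen by (meson add_left_mono diff_le_mono subsetD)
        qed simp
        then show "f \<in> ideal_power (ideal_gen (l ` S)) (d + card S - card {1..n})" by simp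
      qed
    qed
  qed
  finally show ?thesis using primary by blast
qed

end
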